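(* Let $0<q<1$, let $\alpha>0$ be real, let $0<a<x<1$, and let $b,c,d$ be parameters (complex numbers). If $|qabcd|<1$, then $$ \int_{-\infty}^{\infty}\frac{h(i\sinh t;qa,qb,qc,qd)}{h(\cosh 2t;-q)}\sum_{k=0}^{\infty}\frac{x^{\alpha+k}(a/x;q)_{\alpha+k}}{a^{k}(q;q)_{\alpha+k}}\;{}_4\phi_3\left[\begin{matrix}q^{-k},\,qab,\,qac,\,qad\\ iaqe^{t},\,-iaqe^{-t},\,qabcd\end{matrix};q,q\right]dt $$ $$ =\frac{(q,qab,qac,qad,qbc,qbd,qcd;q)_\infty}{(qabcd;q)_\infty}\cdot\frac{x^{\alpha}(a/x;q)_\alpha}{(q;q)_\alpha}\,\log(q^{-1}). $$
   Context: Notation ($0<q<1$). $(c;q)_0=1$, $(c;q)_n=\prod_{k=0}^{n-1}(1-cq^k)$, $(c;q)_\infty=\prod_{k=0}^{\infty}(1-cq^k)$; for real $\nu$, $(c;q)_\nu=(c;q)_\infty/(cq^{\nu};q)_\infty$ (the standard extension). For $n$ a nonnegative integer or $\infty$, $(c_1,\dots,c_m;q)_n=(c_1;q)_n\cdots(c_m;q)_n$. Basic hypergeometric series: $${}_r\phi_s\left[\begin{matrix}a_1,\dots,a_r\\ b_1,\dots,b_s\end{matrix};q,w\right]=\sum_{n=0}^\infty\frac{(a_1,\dots,a_r;q)_n}{(q,b_1,\dots,b_s;q)_n}\left[(-1)^nq^{n(n-1)/2}\right]^{1+s-r}w^n ;$$ in particular, with $q^{-k}$ as an upper parameter ($k$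 a nonnegative integer) the series terminates at $n=k$. $h(\cos\theta;p)=(pe^{i\theta},pe^{-i\theta};q)_\infty$, so that $h(\cosh 2t;-q)=(-qe^{2t},-qe^{-2t};q)_\infty$. Also $h(i\sinh t;p)=\prod_{k=0}^\infty(1-2iq^kp\sinh t+q^{2k}p^2)=(ipe^{t},-ipe^{-t};q)_\infty$, and $h(i\sinh t;p_1,\dots,p_m)=h(i\sinh t;p_1)\cdots h(i\sinh t;p_m)$.
   Formalization: The conditions |qxb|,|qxc|,|qxd|<1 and |qxbcd|<1 are added: under |qabcd|<1 alone the k-series can diverge for every t (q=.5, a=.1, x=.9, b=10, c=d=0) or the integral can diverge (b=c=d=1.5). *)

theory Defs
  imports "HOL-Analysis.Analysis"
begin

text \<open>The base \<open>q\<close> is real; everywhere below it is used with \<open>0 < q < 1\<close>.\<close>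

definition qpoch :: "real \<Rightarrow> complex \<Rightarrow> nat \<Rightarrow> complex" where
  "qpoch q c n = (\<Prod>k<n. 1 - c * of_real q ^ k)"

definition qpoch_inf :: "real \<Rightarrow> complex \<Rightarrow> complex" where
  "qpoch_inf q c = (\<Prod>k. 1 - c * of_real q ^ k)"

definition qpoch_real :: "real \<Rightarrow> complex \<Rightarrow> real \<Rightarrow> complex" where
  "qpoch_real q c \<nu> = qpoch_inf q c / qpoch_inf q (c * of_real (q powr \<nu>))"

definition qpochs :: "real \<Rightarrow> complex list \<Rightarrow> nat \<Rightarrow> complex" where
  "qpochs q cs n = (\<Prod>c\<leftarrow>cs. qpoch q c n)"

definition qpochs_inf :: "real \<Rightarrow> complex list \<Rightarrow> complex" where
  "qpochs_inf q cs = (\<Prod>c\<leftarrow>cs. qpoch_inf q c)"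

text \<open>The series with upper parameters \<open>as\<close> (their number is \<open>r\<close>) and lower parameters \<open>bs\<close>
  (their number is \<open>s\<close>). The exponent \<open>1 + s - r\<close> is an integer that may be negative.\<close>

definition basic_hyp :: "complex list \<Rightarrow> complex list \<Rightarrow> real \<Rightarrow> complex \<Rightarrow> complex" where
  "basic_hyp as bs q w =
     (\<Sum>n. qpochs q as n / qpochs q (of_real q # bs) n
        * ((-1) ^ n * of_real q ^ (n * (n - 1) div 2)) powi (1 + int (length bs) - int (length as))
        * w ^ n)"

text \<open>\<open>h(y; p)\<close> for a complex argument \<open>y\<close>. With \<open>y = cos \<theta>\<close> the quadratic factors split into
  \<open>(p e\<^sup>i\<^sup>\<theta>, p e\<^sup>-\<^sup>i\<^sup>\<theta>; q)\<^sub>\<infinity>\<close>; the lemmas below give this form for the arguments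
  \<open>cos \<theta>\<close>, \<open>cosh u\<close> and \<open>i sinh t\<close>.\<close>

definition h_fun :: "real \<Rightarrow> complex \<Rightarrow> complex \<Rightarrow> complex" where
  "h_fun q y p = (\<Prod>k. 1 - 2 * y * p * of_real q ^ k + p\<^sup>2 * of_real q ^ (2 * k))"

definition h_funs :: "real \<Rightarrow> complex \<Rightarrow> complex list \<Rightarrow> complex" where
  "h_funs q y ps = (\<Prod>p\<leftarrow>ps. h_fun q y p)"

lemma convergent_prod_qpoch:
  assumes "0 < q" "q < 1"
  shows "convergent_prod (\<lambda>k. 1 - c * complex_of_real q ^ k)"
proof -
  have "summable (\<lambda>k. norm (- c * complex_of_real q ^ k))"
    using assms by (auto simp: norm_mult norm_power intro!: summable_mult summable_geometric)
  then have "abs_convergent_prod (\<lambda>k. 1 + (- c * complex_of_real q ^ k))"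
    by (intro summable_imp_abs_convergent_prod) auto
  then show ?thesis
    using abs_convergent_prod_imp_convergent_prod by fastforce
qed

lemma h_fun_factor:
  assumes "0 < q" "q < 1" and uv: "u * v = 1" "u + v = 2 * y"
  shows "h_fun q y p = qpochs_inf q [p * u, p * v]"
proof -
  have eq: "(1 - p * u * of_real q ^ k) * (1 - p * v * of_real q ^ k) =
        1 - 2 * y * p * of_real q ^ k + p\<^sup>2 * of_real q ^ (2 * k)" for k
  proof -
    have "(1 - p * u * of_real q ^ k) * (1 - p * v * of_real q ^ k) =
        1 - (u + v) * p * of_real q ^ k + (u * v) * p\<^sup>2 * (of_real q ^ k)\<^sup>2"
      by (simp add: algebra_simps power2_eq_square)
    then show ?thesis
      by (simp add: uv power_mult[symmetric] mult.commute)
  qed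
  show ?thesis
    unfolding h_fun_def qpochs_inf_def qpoch_inf_def
    using prodinf_mult[OF convergent_prod_qpoch[OF assms(1,2), of "p * u"]
        convergent_prod_qpoch[OF assms(1,2), of "p * v"]]
    by (simp add: eq)
qed

lemma h_fun_cos:
  assumes "0 < q" "q < 1"
  shows "h_fun q (cos \<theta>) p = qpochs_inf q [p * exp (\<i> * \<theta>), p * exp (- \<i> * \<theta>)]"
  by (rule h_fun_factor[OF assms]) (auto simp: exp_minus cos_exp_eq)

lemma h_fun_cosh:
  assumes "0 < q" "q < 1"
  shows "h_fun q (of_real (cosh u)) p = qpochs_inf q [p * of_real (exp u), p * of_real (exp (- u))]"
  by (rule h_fun_factor[OF assms])
    (auto simp: cosh_def of_real_mult[symmetric] exp_minus simp del: of_real_mult)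

lemma h_fun_i_sinh:
  assumes "0 < q" "q < 1"
  shows "h_fun q (\<i> * of_real (sinh t)) p =
    qpochs_inf q [\<i> * p * of_real (exp t), - \<i> * p * of_real (exp (- t))]"
  using h_fun_factor[OF assms, of "\<i> * of_real (exp t)" "- \<i> * of_real (exp (- t))"
      "\<i> * of_real (sinh t)" p]
  by (auto simp: sinh_def of_real_mult[symmetric] exp_minus algebra_simps simp del: of_real_mult)

end

(*
The expression is reduced to Askey's integral
  I(a,b,c,d) = LINT h(i sinh t; qa,qb,qc,qd) / h(cosh 2t; -q)
             = log(1/q) (q,qab,qac,qad,qbc,qbd,qcd;q)_inf / (qabcd;q)_inf.
Invariance of the integral under t -> t + log(1/q), applied to a suitable function g, gives
  (1 - qabcd) I(a,b,c,d) = (1 - qab)(1 - qac)(1 - qad) I(qa,b,c,d);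
iterating sends the parameters to 0 one at a time. The remaining integral of 1 / h(cosh 2t; -q)
is computed from Euler's expansion of (-u;q)_inf at u = e^t / q^N, N -> inf, integrated over one
period (an integrated form of the Jacobi triple product).

Up to a factor independent of t, h(i sinh t; qa) times the k-th 4phi3 is the k-th q-difference at
y = a of f(y) = h(i sinh t; qy) (qybcd;q)_inf / (qyb,qyc,qyd;q)_inf. By Askey's integral and the
terminating q-binomial theorem its integral vanishes for k > 0. The q-difference annihilates powers
of y below the k-th, so it is at most (a/R)^k times a majorant of f on the disc of radius R; choosing
R > x beats the growth (x/a)^k of the coefficients and justifies termwise integration.
*)

theory Submission
  imports Defs
begin

text \<open>Two convergence thresholds shape the proof. When e^t grows by a factor 1/q, the majorant
  \<open>M\<close> of the integrand is multiplied by a factor whose bound tends to q|abcd|, while g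
  carries one more power of e^t and gets |abcd|. Translation of g therefore needs |abcd| < 1 and not
  just |qabcd| < 1. The gap is closed by taking g at a' = qa and writing the integrand at a in terms
  of the one at a'.

  The hypotheses on x make room for R. The possible poles of f are y = 1/(b q^(i+1)), and likewise
  for c and d; |qxb|, |qxc|, |qxd| < 1 place them beyond |y| = x, and |qxbcd| < 1 is Askey's
  condition with x for a. Being strict, these inequalities survive for some R > x. The same R is the
  radius of the majorised expansion and a parameter of the integrable bound: a constant times
  (x/R)^k M(R,|b|,|c|,|d|).

  The bounds on the infinite products rest on one fact: (-r;q)_inf has nonnegative Taylor
  coefficients in r and so dominates (z;q)_inf for |z| <= r.\<close>

lemma summable_norm_ratio_limit:
  fixes f r :: "nat \<Rightarrow> 'a::real_normed_div_algebra"
  assumes "\<And>n. f (Suc n) = r n * f n" "r \<longlonglongrightarrow> l" "norm l < 1"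
  shows "summable (\<lambda>n. norm (f n))"
proof -
  obtain c where c: "norm l < c" "c < 1" using assms(3) dense by blast
  have "eventually (\<lambda>n. norm (r n) < c) sequentially"
    using order_tendstoD(2)[OF tendsto_norm[OF assms(2)] c(1)] .
  then obtain N where "\<And>n. n \<ge> N \<Longrightarrow> norm (r n) < c"
    by (auto simp: eventually_sequentially)
  then show ?thesis
    by (intro summable_ratio_test[OF c(2), of N])
      (simp add: assms(1) norm_mult mult_right_mono less_imp_le)
qed

section \<open>Infinite products in a fixed base q\<close>

locale nome =
  fixes q :: real
  assumes q_pos: "0 < q" and q_less: "q < 1"
begin

abbreviation P :: "complex \<Rightarrow> complex" where "P \<equiv> qpoch_inf q"

lemma qpoch_tendsto: "qpoch q c \<longlonglongrightarrow> P c"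
proof -
  have "(\<lambda>n. qpoch q c (Suc n)) \<longlonglongrightarrow> P c"
    using convergent_prod_LIMSEQ[OF convergent_prod_qpoch[OF q_pos q_less, of c]]
    by (simp add: qpoch_def qpoch_inf_def lessThan_Suc_atMost)
  then show ?thesis by (rule LIMSEQ_imp_Suc)
qed

lemma qpoch_0 [simp]: "qpoch q c 0 = 1"
  by (simp add: qpoch_def)

lemma qpoch_Suc: "qpoch q c (Suc n) = qpoch q c n * (1 - c * of_real q ^ n)"
  by (simp add: qpoch_def)

lemma qpoch_Suc_shift: "qpoch q c (Suc n) = (1 - c) * qpoch q (c * of_real q) n"
  by (simp add: qpoch_def prod.lessThan_Suc_shift mult.assoc del: prod.lessThan_Suc)

lemma P_shift: "P c = (1 - c) * P (c * of_real q)"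
proof (rule LIMSEQ_unique)
  show "(\<lambda>n. qpoch q c (Suc n)) \<longlonglongrightarrow> P c"
    using qpoch_tendsto by (rule LIMSEQ_Suc)
  show "(\<lambda>n. qpoch q c (Suc n)) \<longlonglongrightarrow> (1 - c) * P (c * of_real q)"
    unfolding qpoch_Suc_shift by (intro tendsto_intros qpoch_tendsto)
qed

lemma P_split: "P c = qpoch q c n * P (c * of_real q ^ n)"
proof (induction n)
  case (Suc n)
  then show ?case
    using P_shift[of "c * of_real q ^ n"] by (simp add: qpoch_Suc mult_ac)
qed simp

lemma P_0 [simp]: "P 0 = 1"
  by (simp add: qpoch_inf_def)

lemma qpow_tendsto_0: "(\<lambda>n. z * complex_of_real q ^ n) \<longlonglongrightarrow> 0"
proof -
  have "(\<lambda>n. complex_of_real q ^ n) \<longlonglongrightarrow> 0"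
    using q_pos q_less by (intro LIMSEQ_power_zero) auto
  then show ?thesis by (auto intro: tendsto_mult_right_zero)
qed

lemma norm_mult_q_power_less_1:
  fixes z :: complex
  assumes "norm z < 1"
  shows "norm (z * of_real q ^ n) < 1"
proof -
  have "norm z * q ^ n \<le> norm z * 1" using q_pos q_less by (intro mult_left_mono power_le_one) auto
  then show ?thesis using assms q_pos by (simp add: norm_mult norm_power)
qed

subsection \<open>Euler's expansions\<close>

text \<open>In closed form this is (-1)^n q^(n(n-1)/2) / (q;q)_n, and \<open>euler_inv n\<close> is
  1/(q;q)_n. Both are written as products of consecutive ratios, so that ratio test and recurrence
  are immediate.\<close>

definition euler :: "nat \<Rightarrow> real" where "euler n = (\<Prod>k<n. - (q ^ k) / (1 - q ^ Suc k))"

definition euler_inv :: "nat \<Rightarrow> real" where "euler_inv n = (\<Prod>k<n. 1 / (1 - q ^ Suc k))"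

lemma q_Suc_less_1: "q ^ Suc n < 1"
  using q_pos q_less power_Suc_less_one by blast

lemma q_Suc_neq_1: "1 - q ^ Suc n \<noteq> 0"
  using q_Suc_less_1[of n] by linarith

text \<open>Coefficient form of f(z) - f(qz) = -z f(qz); \<open>euler_inv_rec\<close> is likewise
  f(z) - f(qz) = z f(z).\<close>

lemma euler_rec: "euler (Suc n) * (1 - q ^ Suc n) = - (q ^ n) * euler n"
  using q_Suc_neq_1[of n] by (simp add: euler_def del: power_Suc)

lemma euler_inv_rec: "euler_inv (Suc n) * (1 - q ^ Suc n) = euler_inv n"
  using q_Suc_neq_1[of n] by (simp add: euler_inv_def del: power_Suc)

lemma q_tendsto_0: "(\<lambda>n. q ^ n) \<longlonglongrightarrow> 0"
  using q_pos q_less by (intro LIMSEQ_power_zero) auto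

lemma q_Suc_tendsto_0: "(\<lambda>n. q ^ Suc n) \<longlonglongrightarrow> 0"
  using q_tendsto_0 by (rule LIMSEQ_Suc)

lemma summable_euler: "summable (\<lambda>n. norm (complex_of_real (euler n) * z ^ n))"
proof (rule summable_norm_ratio_limit)
  show "complex_of_real (euler (Suc n)) * z ^ Suc n =
      (of_real (- (q ^ n) / (1 - q ^ Suc n)) * z) * (complex_of_real (euler n) * z ^ n)" for n
    by (simp add: euler_def)
  have "(\<lambda>n. - (q ^ n) / (1 - q ^ Suc n)) \<longlonglongrightarrow> - 0 / (1 - 0)"
    by (rule tendsto_divide tendsto_minus tendsto_diff tendsto_const q_tendsto_0 q_Suc_tendsto_0 | simp)+
  then have "(\<lambda>n. complex_of_real (- (q ^ n) / (1 - q ^ Suc n)) * z) \<longlonglongrightarrow> of_real (- 0 / (1 - 0)) * z"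
    by (intro tendsto_mult tendsto_of_real tendsto_const)
  then show "(\<lambda>n. complex_of_real (- (q ^ n) / (1 - q ^ Suc n)) * z) \<longlonglongrightarrow> 0" by simp
qed simp

lemma summable_euler_inv:
  assumes "norm z < 1"
  shows "summable (\<lambda>n. norm (complex_of_real (euler_inv n) * z ^ n))"
proof (rule summable_norm_ratio_limit)
  show "complex_of_real (euler_inv (Suc n)) * z ^ Suc n =
      (of_real (1 / (1 - q ^ Suc n)) * z) * (complex_of_real (euler_inv n) * z ^ n)" for n
    by (simp add: euler_inv_def)
  have "(\<lambda>n. 1 / (1 - q ^ Suc n)) \<longlonglongrightarrow> 1 / (1 - 0)"
    by (rule tendsto_divide tendsto_minus tendsto_diff tendsto_const q_tendsto_0 q_Suc_tendsto_0 | simp)+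
  then have "(\<lambda>n. complex_of_real (1 / (1 - q ^ Suc n)) * z) \<longlonglongrightarrow> of_real (1 / (1 - 0)) * z"
    by (intro tendsto_mult tendsto_of_real tendsto_const)
  then show "(\<lambda>n. complex_of_real (1 / (1 - q ^ Suc n)) * z) \<longlonglongrightarrow> z" by simp
qed (use assms in simp)

lemma powser_shift_diff:
  fixes c :: "nat \<Rightarrow> real" and z :: complex
  assumes "summable (\<lambda>n. norm (of_real (c n) * z ^ n))"
    and "summable (\<lambda>n. norm (of_real (c n) * (z * of_real q) ^ n))"
  shows "(\<lambda>n. of_real (c (Suc n) * (1 - q ^ Suc n)) * z ^ Suc n) sums
    ((\<Sum>n. of_real (c n) * z ^ n) - (\<Sum>n. of_real (c n) * (z * of_real q) ^ n))"
proof -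
  have "(\<lambda>n. of_real (c n) * z ^ n - of_real (c n) * (z * of_real q) ^ n) sums
     ((\<Sum>n. of_real (c n) * z ^ n) - (\<Sum>n. of_real (c n) * (z * of_real q) ^ n))"
    using assms by (intro sums_diff summable_sums) (auto dest: summable_norm_cancel)
  then have "(\<lambda>n. of_real (c (Suc n)) * z ^ Suc n - of_real (c (Suc n)) * (z * of_real q) ^ Suc n) sums
     ((\<Sum>n. of_real (c n) * z ^ n) - (\<Sum>n. of_real (c n) * (z * of_real q) ^ n))"
    by (subst sums_Suc_iff) simp
  then show ?thesis
    by (rule sums_cong[THEN iffD1, rotated]) (simp add: algebra_simps power_mult_distrib)
qed

text \<open>The series f satisfies f(z) = (1 - z) f(qz), hence f(z) = (z;q)_n f(q^n z). Continuity
  at 0 and f(0) = 1 identify the limit as the infinite product.\<close>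

lemma P_sums: "(\<lambda>n. of_real (euler n) * z ^ n) sums P z"
proof -
  define f where "f = (\<lambda>z::complex. \<Sum>n. of_real (euler n) * z ^ n)"
  have cont: "isCont f 0"
    unfolding f_def by (intro isCont_powser_converges_everywhere summable_norm_cancel[OF summable_euler])
  have f0: "f 0 = 1" unfolding f_def by (subst powser_zero) (simp add: euler_def)
  have step: "f z = (1 - z) * f (z * of_real q)" for z
  proof -
    have "(\<lambda>n. of_real (euler (Suc n) * (1 - q ^ Suc n)) * z ^ Suc n) sums (f z - f (z * of_real q))"
      unfolding f_def by (intro powser_shift_diff summable_euler)
    moreover have "(\<lambda>n. - z * (of_real (euler n) * (z * of_real q) ^ n)) sums (- z * f (z * of_real q))"
      unfolding f_def
      by (intro sums_mult summable_sums summable_norm_cancel[OF summable_euler])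
    ultimately have "f z - f (z * of_real q) = - z * f (z * of_real q)"
      unfolding euler_rec by (intro sums_unique2) (auto simp: power_mult_distrib mult_ac)
    then show ?thesis by (simp add: algebra_simps)
  qed
  have "f z = qpoch q z n * f (z * of_real q ^ n)" for n
  proof (induction n)
    case (Suc n)
    then show ?case using step[of "z * of_real q ^ n"] by (simp add: qpoch_Suc mult_ac)
  qed simp
  moreover have "(\<lambda>n. qpoch q z n * f (z * of_real q ^ n)) \<longlonglongrightarrow> P z * f 0"
    by (intro tendsto_intros qpoch_tendsto isCont_tendsto_compose[OF cont] qpow_tendsto_0)
  ultimately have "(\<lambda>n. f z) \<longlonglongrightarrow> P z" using f0 by simp
  then have "f z = P z" using LIMSEQ_const_iff by blast
  then show ?thesis
    using summable_sums[OF summable_norm_cancel[OF summable_euler, of z]] by (simp add: f_def)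
qed

text \<open>Same argument with (1 - z) f(z) = f(qz), now inside the unit disc only. It ends in
  \<open>P z * f z = 1\<close>, so nonvanishing of the product is a by-product.\<close>

lemma P_inverse_sums:
  assumes "norm z < 1"
  shows "(\<lambda>n. of_real (euler_inv n) * z ^ n) sums (1 / P z)" and P_nonzero: "P z \<noteq> 0"
proof -
  define f where "f = (\<lambda>z::complex. \<Sum>n. of_real (euler_inv n) * z ^ n)"
  have "summable (\<lambda>n. complex_of_real (euler_inv n) * (1/2) ^ n)"
    by (intro summable_norm_cancel[OF summable_euler_inv]) simp
  then have cont: "isCont f 0"
    unfolding f_def by (rule isCont_powser) simp
  have f0: "f 0 = 1" unfolding f_def by (subst powser_zero) (simp add: euler_inv_def)
  have step: "(1 - z) * f z = f (z * of_real q)" if z: "norm z < 1" for z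
  proof -
    have zq: "norm (z * of_real q) < 1" using norm_mult_q_power_less_1[OF z, of 1] by simp
    have "(\<lambda>n. of_real (euler_inv (Suc n) * (1 - q ^ Suc n)) * z ^ Suc n) sums (f z - f (z * of_real q))"
      unfolding f_def by (intro powser_shift_diff summable_euler_inv z zq)
    moreover have "(\<lambda>n. z * (of_real (euler_inv n) * z ^ n)) sums (z * f z)"
      unfolding f_def
      by (intro sums_mult summable_sums summable_norm_cancel[OF summable_euler_inv] z)
    ultimately have "f z - f (z * of_real q) = z * f z"
      unfolding euler_inv_rec by (intro sums_unique2) (auto simp: mult_ac)
    then show ?thesis by (simp add: algebra_simps)
  qed
  have zn: "norm (z * of_real q ^ n) < 1" for n
    by (rule norm_mult_q_power_less_1[OF assms])
  have "qpoch q z n * f z = f (z * of_real q ^ n)" for n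
  proof (induction n)
    case (Suc n)
    have "qpoch q z (Suc n) * f z = (1 - z * of_real q ^ n) * f (z * of_real q ^ n)"
      unfolding Suc[symmetric] by (simp add: qpoch_Suc)
    then show ?case using step[OF zn, of n] by (simp add: mult.assoc power_commutes)
  qed simp
  moreover have "(\<lambda>n. qpoch q z n * f z) \<longlonglongrightarrow> P z * f z"
    by (intro tendsto_intros qpoch_tendsto)
  moreover have "(\<lambda>n. f (z * of_real q ^ n)) \<longlonglongrightarrow> f 0"
    by (intro isCont_tendsto_compose[OF cont] qpow_tendsto_0)
  ultimately have "P z * f z = 1" using f0 LIMSEQ_unique by auto
  then show "P z \<noteq> 0" by auto
  have "f z = 1 / P z" using \<open>P z * f z = 1\<close> by (auto simp: eq_divide_eq mult.commute)
  then show "(\<lambda>n. of_real (euler_inv n) * z ^ n) sums (1 / P z)"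
    using summable_sums[OF summable_norm_cancel[OF summable_euler_inv[OF assms]]] by (simp add: f_def)
qed

lemma isCont_P [continuous_intros]: "isCont P z"
proof -
  have "P = (\<lambda>z. \<Sum>n. of_real (euler n) * z ^ n)"
    using P_sums by (auto simp: sums_iff)
  then show ?thesis
    using isCont_powser_converges_everywhere[OF summable_norm_cancel[OF summable_euler]] by metis
qed

lemma continuous_on_P [continuous_intros]:
  "continuous_on S f \<Longrightarrow> continuous_on S (\<lambda>x. P (f x))"
  by (rule continuous_on_compose2[of UNIV P]) (auto intro!: continuous_at_imp_continuous_on isCont_P)

lemma tendsto_P: "(f \<longlongrightarrow> l) F \<Longrightarrow> ((\<lambda>x. P (f x)) \<longlongrightarrow> P l) F"
  using isCont_tendsto_compose[OF isCont_P] .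

text \<open>\<open>A r\<close> is \<open>(-r; q)\<^sub>\<infinity>\<close>, for \<open>r \<ge> 0\<close> the maximum of \<open>norm (P z)\<close> on the circle \<open>norm z = r\<close>.\<close>

definition A :: "real \<Rightarrow> real" where "A r = Re (P (- of_real r))"

text \<open>The signs of Euler's coefficients alternate, so evaluation at -r makes every term
  nonnegative. Positivity, monotonicity and the majorant property of \<open>A\<close> are all read
  off from this series.\<close>

lemma abs_euler_sums: "(\<lambda>n. \<bar>euler n\<bar> * r ^ n) sums A r"
  and of_real_A: "of_real (A r) = P (- of_real r)"
proof -
  have *: "euler n * (-1) ^ n = \<bar>euler n\<bar>" for n
  proof -
    have "euler n * (-1) ^ n = (\<Prod>k<n. q ^ k / (1 - q ^ Suc k))"
      unfolding euler_def by (induction n) auto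
    moreover have "\<dots> \<ge> 0"
      using q_pos q_Suc_less_1 by (intro prod_nonneg divide_nonneg_nonneg ballI) (auto simp: less_imp_le)
    moreover have "\<bar>euler n\<bar> = \<bar>euler n * (-1) ^ n\<bar>" by (simp add: abs_mult power_abs)
    ultimately show ?thesis by simp
  qed
  have "of_real (euler n) * (- complex_of_real r) ^ n = of_real (\<bar>euler n\<bar> * r ^ n)" for n
    by (subst *[symmetric]) (simp add: power_minus[of "complex_of_real r"])
  then have s: "(\<lambda>n. complex_of_real (\<bar>euler n\<bar> * r ^ n)) sums P (- of_real r)"
    using P_sums[of "- of_real r"] by simp
  show 1: "(\<lambda>n. \<bar>euler n\<bar> * r ^ n) sums A r"
    using sums_Re[OF s] by (simp add: A_def)
  show "of_real (A r) = P (- of_real r)"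
    using sums_unique2[OF sums_of_real[OF 1] s] .
qed

lemma A_eq_suminf: "A r = (\<Sum>n. \<bar>euler n\<bar> * r ^ n)"
  using abs_euler_sums by (simp add: sums_iff)

lemma A_shift: "A r = (1 + r) * A (q * r)"
proof -
  have "complex_of_real (A r) = of_real ((1 + r) * A (q * r))"
    unfolding of_real_mult of_real_A of_real_add by (subst P_shift) (simp add: mult.commute)
  then show ?thesis by (simp only: of_real_eq_iff)
qed

lemma A_ge_1: assumes "r \<ge> 0" shows "A r \<ge> 1"
proof -
  have "sum (\<lambda>n. \<bar>euler n\<bar> * r ^ n) {..<1} \<le> A r"
    using abs_euler_sums[of r] assms unfolding A_eq_suminf
    by (intro sum_le_suminf) (auto simp: sums_iff)
  then show ?thesis by (simp add: euler_def)
qed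

lemma A_pos: "r \<ge> 0 \<Longrightarrow> A r > 0"
  using A_ge_1[of r] by linarith

lemma A_mono: assumes "0 \<le> r" "r \<le> s" shows "A r \<le> A s"
  unfolding A_eq_suminf using abs_euler_sums assms
  by (intro suminf_le mult_left_mono power_mono) (auto simp: sums_iff)

lemma norm_P_le: assumes "norm z \<le> r" shows "norm (P z) \<le> A r"
proof -
  have n: "norm (of_real (euler n) * z ^ n) \<le> \<bar>euler n\<bar> * r ^ n" for n
    using assms by (auto simp: norm_mult norm_power intro!: mult_left_mono power_mono)
  have "P z = (\<Sum>n. of_real (euler n) * z ^ n)" using P_sums by (simp add: sums_iff)
  also have "norm \<dots> \<le> A r" unfolding A_eq_suminf
    using abs_euler_sums n by (intro norm_suminf_le) (auto simp: sums_iff)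
  finally show ?thesis .
qed

lemma continuous_on_A [continuous_intros]:
  "continuous_on S f \<Longrightarrow> continuous_on S (\<lambda>x. A (f x))"
  unfolding A_def by (intro continuous_intros)

end

section \<open>Integrability from decay under translation\<close>

lemma integrable_exp_decay:
  fixes f :: "real \<Rightarrow> real"
  assumes "0 < \<delta>" and [measurable]: "f \<in> borel_measurable borel"
    and f: "\<And>t. \<bar>f t\<bar> \<le> K * exp (- \<delta> * \<bar>t\<bar>)"
  shows "integrable lborel f"
proof -
  define h where "h = (\<lambda>t::real. indicator {0..} t * exp (- \<delta> * t))"
  have [measurable]: "h \<in> borel_measurable borel" unfolding h_def by measurable
  have "(\<lambda>t. exp (- \<delta> * t)) absolutely_integrable_on {0..}"
    using assms(1) by (intro nonnegative_absolutely_integrable_1 integrable_on_exp_minus_to_infinity) auto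
  then have "integrable lebesgue h"
    by (simp add: set_integrable_def h_def)
  then have h: "integrable lborel h"
    by (subst (asm) integrable_completion) auto
  moreover have "integrable lborel (\<lambda>t. h (0 + (-1) * t))"
    using h by (intro lborel_integrable_real_affine) auto
  ultimately have "integrable lborel (\<lambda>t. K * (h t + h (0 + (-1) * t)))"
    by (intro integrable_mult_right Bochner_Integration.integrable_add)
  then show ?thesis
  proof (rule Bochner_Integration.integrable_bound)
    have "\<bar>f t\<bar> \<le> \<bar>K * (h t + h (0 + (-1) * t))\<bar>" for t
    proof -
      have "K \<ge> 0" using order_trans[OF abs_ge_zero f[of 0]] by simp
      moreover have "exp (- \<delta> * \<bar>t\<bar>) \<le> h t + h (0 + (-1) * t)"
        by (auto simp: h_def indicator_def)
      ultimately have "K * exp (- \<delta> * \<bar>t\<bar>) \<le> K * (h t + h (0 + (-1) * t))"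
        by (intro mult_left_mono)
      then show ?thesis using f[of t] by linarith
    qed
    then show "AE t in lborel. norm (f t) \<le> norm (K * (h t + h (0 + (-1) * t)))" by simp
  qed simp
qed

text \<open>A factor \<rho> per step of length \<open>L\<close> is the exponential rate \<delta>
  with exp (-\<delta> L) = \<rho>. Compactness bounds \<open>f\<close> on an initial interval,
  induction extends the bound by one step at a time, and evenness covers negative
  \<open>t\<close>.\<close>

lemma integrable_geometric_decay:
  fixes f :: "real \<Rightarrow> real"
  assumes cont: "continuous_on UNIV f" and nonneg: "\<And>t. 0 \<le> f t" and even: "\<And>t. f (- t) = f t"
    and L: "0 < L" and \<rho>: "0 < \<rho>" "\<rho> < 1" and T: "0 \<le> T"
    and step: "\<And>t. T \<le> t \<Longrightarrow> f (t + L) \<le> \<rho> * f t"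
  shows "integrable lborel f"
proof -
  define \<delta> where "\<delta> = - ln \<rho> / L"
  have \<delta>: "\<delta> > 0" using L \<rho> by (auto simp: \<delta>_def intro!: divide_neg_pos)
  have exp_\<delta>: "exp (\<delta> * L) * \<rho> = 1"
    using L \<rho> by (simp add: \<delta>_def exp_minus)
  have "compact (f ` {0..T+L})"
    by (intro compact_continuous_image continuous_on_subset[OF cont]) auto
  then have "bdd_above (f ` {0..T+L})" by (intro bounded_imp_bdd_above compact_imp_bounded)
  then obtain C where C: "\<And>t. t \<in> {0..T+L} \<Longrightarrow> f t \<le> C"
    unfolding bdd_above_def by blast
  \<comment> \<open>Chosen so that K exp (-\<delta> t) is at least \<open>C\<close> on all of
    [0, T + L], the base case of the induction.\<close>
  define K where "K = C * exp (\<delta> * (T + L))"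
  have C0: "C \<ge> 0" using C[of 0] nonneg[of 0] T L by auto
  have "\<forall>t\<in>{0..T + L + real n * L}. f t \<le> K * exp (- \<delta> * t)" for n
  proof (induction n)
    case 0
    show ?case
    proof
      fix t assume t: "t \<in> {0..T + L + real 0 * L}"
      then have "f t \<le> C * 1" using C by simp
      also have "\<dots> \<le> C * exp (\<delta> * (T + L - t))"
        using C0 \<delta> t by (intro mult_left_mono) auto
      also have "exp (\<delta> * (T + L - t)) = exp (\<delta> * (T + L)) * exp (- \<delta> * t)"
        by (simp add: algebra_simps flip: exp_add)
      finally show "f t \<le> K * exp (- \<delta> * t)" by (simp add: K_def mult.assoc)
    qed
  next
    case (Suc n)
    show ?case
    proof
      fix t assume t: "t \<in> {0..T + L + real (Suc n) * L}"
      show "f t \<le> K * exp (- \<delta> * t)"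
      proof (cases "t \<le> T + L")
        case True
        have "real n * L \<ge> 0" using L by simp
        then show ?thesis using Suc t True by auto
      next
        case False
        have "f t \<le> \<rho> * f (t - L)" using step[of "t - L"] False by simp
        also have "f (t - L) \<le> K * exp (- \<delta> * (t - L))"
        proof -
          have "t - L \<in> {0..T + L + real n * L}" using t False T by (simp add: algebra_simps)
          then show ?thesis using Suc by blast
        qed
        also have "\<rho> * (K * exp (- \<delta> * (t - L))) = K * exp (- \<delta> * t) * (exp (\<delta> * L) * \<rho>)"
          by (simp add: algebra_simps flip: exp_add)
        finally show ?thesis using \<rho> by (simp add: exp_\<delta>)
      qed
    qed
  qed note bound = this
  have pos: "f t \<le> K * exp (- \<delta> * t)" if "t \<ge> 0" for t
  proof -
    obtain n where "t / L \<le> real n" using real_arch_simple by blast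
    then have "t \<le> T + L + real n * L" using L T by (simp add: field_simps add_increasing)
    then show ?thesis using bound[of n] that by auto
  qed
  show ?thesis
  proof (rule integrable_exp_decay[OF \<delta>])
    show "f \<in> borel_measurable borel" using cont by (rule borel_measurable_continuous_onI)
    show "\<bar>f t\<bar> \<le> K * exp (- \<delta> * \<bar>t\<bar>)" for t
      using pos[of t] pos[of "- t"] nonneg[of t] even[of t] by (cases "t \<ge> 0") auto
  qed
qed

section \<open>The weight, its majorant and their integrability\<close>

context nome
begin

definition L :: real where "L = ln (1 / q)"

lemma L_pos: "L > 0" and exp_L: "exp L = 1 / q"
  using q_pos q_less by (auto simp: L_def)

lemma exp_add_L: "exp (t + L) = exp t / q" and exp_diff_L: "exp (t - L) = q * exp t"
  using q_pos by (auto simp: exp_add exp_diff exp_L)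

text \<open>The variable \<open>u\<close> stands for \<open>e\<^sup>t\<close> throughout, so that \<open>H p u\<close> is \<open>h(i sinh t; q p)\<close> and
  \<open>D u\<close> is \<open>h(cosh 2t; -q)\<close>; translating \<open>t\<close> by \<open>L\<close> replaces \<open>u\<close> by \<open>u / q\<close>. The functions
  \<open>HA\<close> and \<open>M\<close> are majorants.\<close>

definition H :: "complex \<Rightarrow> real \<Rightarrow> complex" where
  "H p u = P (\<i> * of_real q * p * of_real u) * P (- \<i> * of_real q * p / of_real u)"

definition D :: "real \<Rightarrow> real" where
  "D u = A (q * u\<^sup>2) * A (q / u\<^sup>2)"

definition HA :: "real \<Rightarrow> real \<Rightarrow> real" where
  "HA p u = A (q * p * u) * A (q * p / u)"

definition M :: "real \<Rightarrow> real \<Rightarrow> real \<Rightarrow> real \<Rightarrow> real \<Rightarrow> real" where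
  "M a b c d u = HA a u * HA b u * HA c u * HA d u / D u"

definition W :: "complex \<Rightarrow> complex \<Rightarrow> complex \<Rightarrow> complex \<Rightarrow> real \<Rightarrow> complex" where
  "W a b c d u = H a u * H b u * H c u * H d u / of_real (D u)"

lemma D_pos: "u > 0 \<Longrightarrow> D u > 0"
  using q_pos by (auto simp: D_def intro!: mult_pos_pos A_pos)

lemma HA_pos: "u > 0 \<Longrightarrow> p \<ge> 0 \<Longrightarrow> HA p u > 0"
  using q_pos by (auto simp: HA_def intro!: mult_pos_pos A_pos)

lemma D_nonzero: "u > 0 \<Longrightarrow> D u \<noteq> 0"
  using D_pos[of u] by linarith

lemma HA_nonneg: "u > 0 \<Longrightarrow> p \<ge> 0 \<Longrightarrow> HA p u \<ge> 0"
  using HA_pos by (rule less_imp_le)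

lemma M_nonneg: "u > 0 \<Longrightarrow> a \<ge> 0 \<Longrightarrow> b \<ge> 0 \<Longrightarrow> c \<ge> 0 \<Longrightarrow> d \<ge> 0 \<Longrightarrow> M a b c d u \<ge> 0"
  unfolding M_def by (intro mult_nonneg_nonneg divide_nonneg_pos HA_nonneg D_pos)

lemma HA_shift:
  assumes "u > 0" "p \<ge> 0"
  shows "HA p (u / q) \<le> (1 + p * u) * HA p u"
proof -
  have "HA p (u / q) = A (p * u) * A (q * (q * p / u))"
    using q_pos by (simp add: HA_def mult_ac)
  also have "\<dots> = (1 + p * u) * A (q * p * u) * A (q * (q * p / u))"
    by (subst A_shift) (simp add: mult.assoc)
  also have "\<dots> \<le> (1 + p * u) * A (q * p * u) * A (q * p / u)"
    using assms q_pos q_less A_pos[of "q * p * u"]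
    by (intro mult_left_mono A_mono mult_left_le_one_le) auto
  finally show ?thesis by (simp add: HA_def mult.assoc)
qed

text \<open>\<open>D\<close> stands in the denominator of \<open>M\<close>, where the one-sided
  bound used for \<open>HA\<close> would point the wrong way; hence an exact identity.\<close>

lemma D_shift:
  assumes "u > 0"
  shows "D (u / q) * ((1 + q / u\<^sup>2) * (1 + q\<^sup>2 / u\<^sup>2)) = (1 + u\<^sup>2 / q) * (1 + u\<^sup>2) * D u"
proof -
  have 1: "A (u\<^sup>2 / q) = (1 + u\<^sup>2 / q) * ((1 + u\<^sup>2) * A (q * u\<^sup>2))"
    using A_shift[of "u\<^sup>2 / q"] A_shift[of "u\<^sup>2"] q_pos by simp
  have 2: "A (q / u\<^sup>2) = (1 + q / u\<^sup>2) * ((1 + q\<^sup>2 / u\<^sup>2) * A (q ^ 3 / u\<^sup>2))"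
    using A_shift[of "q / u\<^sup>2"] A_shift[of "q\<^sup>2 / u\<^sup>2"] by (simp add: power2_eq_square power3_eq_cube mult.assoc)
  have "D (u / q) = A (u\<^sup>2 / q) * A (q ^ 3 / u\<^sup>2)"
    using q_pos by (simp add: D_def power_divide power2_eq_square power3_eq_cube mult.assoc)
  then show ?thesis unfolding D_def 1 2 by (simp add: mult_ac)
qed

text \<open>The factor on the right is a function of 1/u, so its behaviour for large u is its value
  at 0, namely abcd. The weight u + 1/u is the extra growth that \<open>g_shift\<close> brings in
  later.\<close>

lemma M_shift:
  assumes u: "u > 0" and p: "a \<ge> 0" "b \<ge> 0" "c \<ge> 0" "d \<ge> 0"
  shows "M a b c d (u / q) * (u / q + q / u) \<le>
    ((1 / u + a) * (1 / u + b) * (1 / u + c) * (1 / u + d) * (1 + q / u\<^sup>2) * (1 + q\<^sup>2 / u\<^sup>2) * (1 / q + q / u\<^sup>2)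
      / ((1 / u\<^sup>2 + 1 / q) * (1 / u\<^sup>2 + 1) * (1 + 1 / u\<^sup>2))) * (M a b c d u * (u + 1 / u))"
    (is "?lhs \<le> ?rhs")
proof -
  let ?E = "(1 + q / u\<^sup>2) * (1 + q\<^sup>2 / u\<^sup>2)" and ?F = "(1 + u\<^sup>2 / q) * (1 + u\<^sup>2)"
  have E: "?E > 0" using u q_pos by (intro mult_pos_pos add_pos_pos divide_pos_pos) auto
  have F: "?F > 0" using u q_pos by (intro mult_pos_pos add_pos_pos divide_pos_pos) auto
  have D: "D (u / q) = ?F * D u / ?E"
    using D_shift[OF u] E by (intro nonzero_eq_divide_eq[THEN iffD2]) linarith+
  have nn: "HA p (u / q) \<ge> 0" "HA p u \<ge> 0" if "p \<ge> 0" for p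
    using u q_pos that by (simp_all add: HA_nonneg)
  have "M a b c d (u / q) \<le> (((1 + a * u) * HA a u) * ((1 + b * u) * HA b u) * ((1 + c * u) * HA c u)
      * ((1 + d * u) * HA d u)) / D (u / q)"
    unfolding M_def using u p q_pos D_pos[of "u / q"]
    by (intro divide_right_mono mult_mono HA_shift mult_nonneg_nonneg nn add_nonneg_nonneg) auto
  also have "\<dots> = (1 + a * u) * (1 + b * u) * (1 + c * u) * (1 + d * u) * ?E / ?F * M a b c d u"
    unfolding D M_def using D_pos[OF u] by (simp add: mult_ac)
  finally have "?lhs \<le> (1 + a * u) * (1 + b * u) * (1 + c * u) * (1 + d * u) * ?E / ?F * M a b c d u
      * (u / q + q / u)"
    using u q_pos by (intro mult_right_mono) auto
  also have "\<dots> = ?rhs"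
  proof -
    have e1: "1 + p * u = (1 / u + p) * u" for p using u by (simp add: field_simps)
    have e2: "1 + u\<^sup>2 / q = (1 / u\<^sup>2 + 1 / q) * u\<^sup>2" "1 + u\<^sup>2 = (1 / u\<^sup>2 + 1) * u\<^sup>2"
      using u by (simp_all add: field_simps)
    have e3: "u / q + q / u = (1 / q + q / u\<^sup>2) * u" "u + 1 / u = (1 + 1 / u\<^sup>2) * u"
      using u by (simp_all add: field_simps power2_eq_square)
    have n: "1 / u\<^sup>2 + 1 / q \<noteq> 0" "1 / u\<^sup>2 + 1 \<noteq> 0" "1 + 1 / u\<^sup>2 \<noteq> 0"
    proof -
      have "1 / u\<^sup>2 > 0" "1 / q > 0" using u q_pos by simp_all
      then show "1 / u\<^sup>2 + 1 / q \<noteq> 0" "1 / u\<^sup>2 + 1 \<noteq> 0" "1 + 1 / u\<^sup>2 \<noteq> 0" by linarith+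
    qed
    \<comment> \<open>With abstract coefficients only the powers of u are left: u^4 above cancels
      u^2 u^2 below, and one u passes from \<open>Q\<close> to \<open>R\<close>.\<close>
    have "X * u * (Y * u) * (Z * u) * (V * u) * E / (G * u\<^sup>2 * (J * u\<^sup>2)) * N * (Q * u) =
        X * Y * Z * V * E1 * E2 * Q / (G * J * R) * (N * (R * u))"
      if "E = E1 * E2" "G \<noteq> 0" "J \<noteq> 0" "R \<noteq> 0"
      for X Y Z V E E1 E2 G J N Q R :: real
      using u that by (simp add: field_simps power2_eq_square)
    then show ?thesis unfolding e1 e2 e3 using n by simp
  qed
  finally show ?thesis .
qed

lemma M_inverse: "M a b c d (1 / u) = M a b c d u"
  by (simp add: M_def HA_def D_def power_divide mult_ac)

lemma continuous_on_M:
  assumes "\<And>x. x \<in> S \<Longrightarrow> f x > 0" "continuous_on S f"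
  shows "continuous_on S (\<lambda>x. M a b c d (f x))"
  unfolding M_def HA_def D_def using assms(1) D_nonzero[unfolded D_def]
  by (intro continuous_intros assms(2)) (auto dest: assms(1))

text \<open>The step ratio tends to abcd, so from some point on it stays below \<rho>, the midpoint
  of abcd and 1. Symmetry under u -> 1/u supplies evenness in t.\<close>

lemma integrable_M_cosh:
  assumes p: "a \<ge> 0" "b \<ge> 0" "c \<ge> 0" "d \<ge> 0" and abcd: "a * b * c * d < 1"
  shows "integrable lborel (\<lambda>t. M a b c d (exp t) * (exp t + 1 / exp t))"
proof -
  define R where "R = (\<lambda>y. (y + a) * (y + b) * (y + c) * (y + d) * (1 + q * y\<^sup>2) * (1 + q\<^sup>2 * y\<^sup>2) * (1 / q + q * y\<^sup>2)
      / ((y\<^sup>2 + 1 / q) * (y\<^sup>2 + 1) * (1 + y\<^sup>2)))"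
  define \<rho> where "\<rho> = (1 + a * b * c * d) / 2"
  have abcd0: "a * b * c * d \<ge> 0" using p by simp
  have \<rho>: "0 < \<rho>" "\<rho> < 1" "a * b * c * d < \<rho>" using abcd abcd0 by (simp_all add: \<rho>_def)
  have "((\<lambda>t::real. exp (- t)) \<longlongrightarrow> (0::real)) at_top"
    by (rule filterlim_compose[OF exp_at_bot filterlim_uminus_at_bot_at_top])
  then have "((\<lambda>t. R (exp (- t))) \<longlongrightarrow> (0 + a) * (0 + b) * (0 + c) * (0 + d) * (1 + q * 0\<^sup>2) * (1 + q\<^sup>2 * 0\<^sup>2) * (1 / q + q * 0\<^sup>2)
      / ((0\<^sup>2 + 1 / q) * (0\<^sup>2 + 1) * (1 + 0\<^sup>2))) at_top"
    unfolding R_def using q_pos by (intro tendsto_intros) auto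
  then have "((\<lambda>t. R (exp (- t))) \<longlongrightarrow> a * b * c * d) at_top" using q_pos by simp
  then have "eventually (\<lambda>t. R (exp (- t)) < \<rho>) at_top" using \<rho>(3) by (rule order_tendstoD(2))
  then obtain T0 where T0: "\<And>t. t \<ge> T0 \<Longrightarrow> R (exp (- t)) < \<rho>"
    by (auto simp: eventually_at_top_linorder)
  show ?thesis
  proof (rule integrable_geometric_decay[where L = L and \<rho> = \<rho> and T = "max 0 T0"])
    show "continuous_on UNIV (\<lambda>t. M a b c d (exp t) * (exp t + 1 / exp t))"
      by (intro continuous_intros continuous_on_M) auto
    show nn: "0 \<le> M a b c d (exp t) * (exp t + 1 / exp t)" for t
      using M_nonneg[of "exp t" a b c d] p by (intro mult_nonneg_nonneg) auto
    show "M a b c d (exp (- t)) * (exp (- t) + 1 / exp (- t)) = M a b c d (exp t) * (exp t + 1 / exp t)" for t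
      using M_inverse[of a b c d "exp t"] by (simp add: exp_minus field_simps)
    show "M a b c d (exp (t + L)) * (exp (t + L) + 1 / exp (t + L))
      \<le> \<rho> * (M a b c d (exp t) * (exp t + 1 / exp t))" if "max 0 T0 \<le> t" for t
    proof -
      have "M a b c d (exp (t + L)) * (exp (t + L) + 1 / exp (t + L)) \<le>
          R (exp (- t)) * (M a b c d (exp t) * (exp t + 1 / exp t))"
        using M_shift[of "exp t" a b c d] p
        by (simp add: exp_add_L R_def exp_minus inverse_eq_divide power_divide)
      also have "\<dots> \<le> \<rho> * (M a b c d (exp t) * (exp t + 1 / exp t))"
        using T0[of t] that nn[of t] by (intro mult_right_mono) auto
      finally show ?thesis .
    qed
  qed (use L_pos \<rho> in auto)
qed

lemma HA_step: "HA a u = (1 + q * a * u) * (1 + q * a / u) * HA (q * a) u"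
  unfolding HA_def using A_shift[of "q * a * u"] A_shift[of "q * a / u"] by (simp add: mult_ac)

text \<open>The weaker condition qabcd < 1 is reached by peeling off one factor:
  \<open>HA a u\<close> is (1 + qau)(1 + qa/u) times \<open>HA (q * a) u\<close>, and the two
  factors are at most (1 + qa)^2 (u + 1/u). This is the previous situation with qa in place of
  a.\<close>

lemma integrable_M:
  assumes p: "a \<ge> 0" "b \<ge> 0" "c \<ge> 0" "d \<ge> 0" and abcd: "q * a * b * c * d < 1"
  shows "integrable lborel (\<lambda>t. M a b c d (exp t))"
proof (rule Bochner_Integration.integrable_bound)
  let ?C = "(1 + q * a)\<^sup>2"
  have "integrable lborel (\<lambda>t. M (q * a) b c d (exp t) * (exp t + 1 / exp t))"
    using p abcd q_pos by (intro integrable_M_cosh) auto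
  then show "integrable lborel (\<lambda>t. ?C * (M (q * a) b c d (exp t) * (exp t + 1 / exp t)))" by simp
  show "(\<lambda>t. M a b c d (exp t)) \<in> borel_measurable lborel"
    unfolding measurable_lborel2
    by (intro borel_measurable_continuous_onI continuous_on_M continuous_intros) auto
  have "norm (M a b c d (exp t)) \<le> norm (?C * (M (q * a) b c d (exp t) * (exp t + 1 / exp t)))" for t
  proof -
    define u where "u = exp t"
    have u: "u > 0" by (simp add: u_def)
    have M0: "M (q * a) b c d u \<ge> 0" using u p q_pos by (intro M_nonneg) auto
    define r s where "r = q * a" and "s = u + 1 / u"
    have r: "r \<ge> 0" using p q_pos by (simp add: r_def)
    have s: "2 \<le> s"
      using u sum_squares_bound[of 1 u] by (simp add: s_def field_simps power2_eq_square)
    have "(1 + r * u) * (1 + r / u) = 1 + r\<^sup>2 + r * s"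
      using u by (simp add: s_def field_simps power2_eq_square)
    also have "\<dots> \<le> (1 + r\<^sup>2) * s + 2 * r * s"
    proof -
      have "(1 + r\<^sup>2) * 1 \<le> (1 + r\<^sup>2) * s" using s by (intro mult_left_mono) auto
      moreover have "r * s \<ge> 0" using r s by simp
      ultimately show ?thesis by simp
    qed
    also have "\<dots> = (1 + r)\<^sup>2 * s" by (simp add: power2_eq_square algebra_simps)
    finally have "(1 + q * a * u) * (1 + q * a / u) \<le> ?C * (u + 1 / u)" by (simp add: r_def s_def)
    then have "(1 + q * a * u) * (1 + q * a / u) * M (q * a) b c d u \<le> ?C * (u + 1 / u) * M (q * a) b c d u"
      using M0 by (rule mult_right_mono)
    moreover have "M a b c d u = (1 + q * a * u) * (1 + q * a / u) * M (q * a) b c d u"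
      unfolding M_def by (subst HA_step) simp
    moreover have "M a b c d u \<ge> 0" using u p by (intro M_nonneg) auto
    ultimately show ?thesis by (simp add: mult_ac flip: u_def)
  qed
  then show "AE t in lborel. norm (M a b c d (exp t)) \<le> norm (?C * (M (q * a) b c d (exp t) * (exp t + 1 / exp t)))"
    by simp
qed

lemma of_real_D: "u > 0 \<Longrightarrow> complex_of_real (D u) = P (- of_real (q * u\<^sup>2)) * P (- of_real (q / u\<^sup>2))"
  by (simp only: D_def of_real_mult of_real_A)

lemma norm_H_le:
  assumes "u > 0" "norm p \<le> r"
  shows "norm (H p u) \<le> HA r u"
proof -
  have n: "norm (\<i> * of_real q * p * of_real u) \<le> q * r * u" "norm (- \<i> * of_real q * p / of_real u) \<le> q * r / u"
    using assms q_pos by (simp_all add: norm_mult norm_divide divide_right_mono)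
  then show ?thesis
    unfolding H_def HA_def norm_mult using assms q_pos order_trans[OF norm_ge_zero assms(2)]
    by (intro mult_mono norm_P_le n less_imp_le[OF A_pos]) auto
qed

lemma norm_W_le:
  assumes "u > 0" "norm a \<le> a'" "norm b \<le> b'" "norm c \<le> c'" "norm d \<le> d'"
  shows "norm (W a b c d u) \<le> M a' b' c' d' u"
proof -
  have nn: "0 \<le> a'" "0 \<le> b'" "0 \<le> c'" "0 \<le> d'"
    using assms(2-) norm_ge_zero order_trans by blast+
  have "norm (H a u) * norm (H b u) * norm (H c u) * norm (H d u) / D u \<le>
      HA a' u * HA b' u * HA c' u * HA d' u / D u"
    using assms nn D_pos[of u] HA_pos[of u]
    by (intro divide_right_mono mult_mono norm_H_le mult_nonneg_nonneg HA_nonneg norm_ge_zero less_imp_le[OF D_pos])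
  then show ?thesis
    using D_pos[OF assms(1)] by (simp add: W_def M_def norm_mult norm_divide)
qed

lemma continuous_on_H: "continuous_on UNIV (\<lambda>t. H p (exp t))"
  unfolding H_def by (intro continuous_intros) auto

lemma continuous_on_D: "continuous_on UNIV (\<lambda>t. D (exp t))"
  unfolding D_def by (intro continuous_intros) auto

lemma continuous_on_W: "continuous_on UNIV (\<lambda>t. W a b c d (exp t))"
  unfolding W_def by (intro continuous_intros continuous_on_H continuous_on_D) (simp add: D_nonzero)

lemma measurable_W [measurable]: "(\<lambda>t. W a b c d (exp t)) \<in> borel_measurable borel"
  by (rule borel_measurable_continuous_onI[OF continuous_on_W])

lemma integrable_W:
  assumes "norm (of_real q * a * b * c * d) < 1"
  shows "integrable lborel (\<lambda>t. W a b c d (exp t))"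
proof (rule Bochner_Integration.integrable_bound)
  show "integrable lborel (\<lambda>t. M (norm a) (norm b) (norm c) (norm d) (exp t))"
    using assms q_pos by (intro integrable_M) (auto simp: norm_mult)
  show "AE t in lborel. norm (W a b c d (exp t)) \<le> norm (M (norm a) (norm b) (norm c) (norm d) (exp t))"
    using norm_W_le[of "exp _" a "norm a" b "norm b" c "norm c" d "norm d"]
    by (auto intro!: AE_I2 order_trans[OF _ abs_ge_self])
qed simp


subsection \<open>The parameter-free integral\<close>

text \<open>Jacobi's theta function without its constant factor (q;q)_inf.\<close>

definition theta :: "real \<Rightarrow> real" where "theta u = A u * A (q / u)"

lemma theta_pos: "u > 0 \<Longrightarrow> theta u > 0"
  using q_pos by (auto simp: theta_def intro!: mult_pos_pos A_pos)

lemma theta_q_mult: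
  assumes "u > 0"
  shows "theta (q * u) = theta u / u"
proof -
  have "theta (q * u) = A (q * u) * A (1 / u)" using q_pos by (simp add: theta_def)
  also have "A (1 / u) = (1 + 1 / u) * A (q / u)" using A_shift[of "1 / u"] by simp
  also have "A (q * u) * ((1 + 1 / u) * A (q / u)) = (1 + u) * A (q * u) * A (q / u) / u"
    using assms by (simp add: field_simps)
  also have "(1 + u) * A (q * u) = A u" by (rule A_shift[symmetric])
  finally show ?thesis by (simp add: theta_def)
qed

text \<open>Iterated quasi-periodicity gives theta(u)/theta(q^k u) = u^k q^(k(k-1)/2), exactly the
  Gaussian factor in Euler's coefficients. What is left is 1/(q;q)_k, so Euler's series becomes a
  weighted sum of translates of 1/theta.\<close>

lemma abs_euler_theta:
  assumes "u > 0"
  shows "\<bar>euler k\<bar> * u ^ k = euler_inv k * (theta u / theta (q ^ k * u))"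
proof (induction k)
  case 0
  show ?case using theta_pos[OF assms] by (simp add: euler_def euler_inv_def)
next
  case (Suc k)
  have uk: "q ^ k * u > 0" using assms q_pos by simp
  have 1: "theta (q ^ Suc k * u) = theta (q ^ k * u) / (q ^ k * u)"
    using theta_q_mult[OF uk] by (simp add: mult.assoc)
  have "\<bar>euler (Suc k)\<bar> * u ^ Suc k = (\<bar>euler k\<bar> * u ^ k) * (q ^ k * u / (1 - q ^ Suc k))"
    using q_Suc_less_1[of k] q_pos by (simp add: euler_def abs_mult)
  also have "\<dots> = euler_inv (Suc k) * (theta u / theta (q ^ Suc k * u))"
    unfolding Suc 1 using uk theta_pos[OF uk] by (simp add: euler_inv_def mult_ac)
  finally show ?case .
qed

lemma sums_inverse_theta:
  assumes "u > 0"
  shows "(\<lambda>k. euler_inv k / theta (q ^ k * u)) sums (1 / A (q / u))"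
proof -
  have "(\<lambda>k. euler_inv k * (theta u / theta (q ^ k * u)) / theta u) sums (A u / theta u)"
    using abs_euler_sums[of u] unfolding abs_euler_theta[OF assms] by (rule sums_divide)
  moreover have "A u / theta u = 1 / A (q / u)"
    using A_pos[of u] assms by (simp add: theta_def)
  ultimately show ?thesis using theta_pos[OF assms] by simp
qed

lemma euler_inv_pos: "euler_inv k > 0"
  unfolding euler_inv_def using q_Suc_less_1 by (intro prod_pos) simp

text \<open>\<open>A (- q)\<close> is (q;q)_inf as a real number. The results for nonnegative
  arguments of \<open>A\<close> do not cover it; its positivity comes below from the increasing
  limit of \<open>euler_inv\<close>.\<close>

lemma of_real_A_neg_q: "of_real (A (- q)) = P (of_real q)"
  by (simp add: of_real_A)

lemma A_neg_q_nonzero: "A (- q) \<noteq> 0"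
  using P_nonzero[of "of_real q"] q_pos q_less of_real_A_neg_q by auto

lemma euler_inv_tendsto: "euler_inv \<longlonglongrightarrow> 1 / A (- q)"
proof -
  have 1: "qpoch q (of_real q) k = of_real (1 / euler_inv k)" for k
    by (simp add: qpoch_def euler_inv_def prod_dividef)
  have "(\<lambda>k. complex_of_real (1 / euler_inv k)) \<longlonglongrightarrow> of_real (A (- q))"
    using qpoch_tendsto[of "of_real q"] unfolding 1 of_real_A_neg_q .
  then have "(\<lambda>k. 1 / euler_inv k) \<longlonglongrightarrow> A (- q)"
    by (simp only: tendsto_of_real_iff)
  then have "(\<lambda>k. 1 / (1 / euler_inv k)) \<longlonglongrightarrow> 1 / A (- q)"
    using A_neg_q_nonzero by (intro tendsto_intros)
  then show ?thesis by simp
qed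

lemma euler_inv_Suc_le: "euler_inv n \<le> euler_inv (Suc n)"
proof -
  have "euler_inv (Suc n) * (1 - q ^ Suc n) \<le> euler_inv (Suc n) * 1"
    using euler_inv_pos[of "Suc n"] q_pos by (intro mult_left_mono) auto
  then show ?thesis by (simp only: euler_inv_rec)
qed

lemma euler_inv_le: "euler_inv k \<le> 1 / A (- q)"
  using incseq_le[OF _ euler_inv_tendsto] euler_inv_Suc_le by (auto simp: incseq_Suc_iff)

lemma A_neg_q_pos: "A (- q) > 0"
  using euler_inv_le[of 0] euler_inv_pos[of 0] by (meson order_less_le_trans zero_less_divide_1_iff)

lemma measurable_inverse_theta: "(\<lambda>t. 1 / theta (exp t)) \<in> borel_measurable borel"
proof (intro borel_measurable_continuous_onI continuous_intros)
  show "continuous_on UNIV (\<lambda>t. theta (exp t))"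
    unfolding theta_def by (intro continuous_intros) auto
  show "\<forall>t\<in>UNIV. theta (exp t) \<noteq> 0" using theta_pos by (metis exp_gt_zero less_irrefl)
qed

lemma exp_add_mult_L: "exp (t + (real N - real k) * L) = q ^ k * exp (t + real N * L)"
  using q_pos exp_of_nat_mult[of k L] by (simp add: exp_diff exp_add exp_L algebra_simps power_divide)

text \<open>Both sides of the identity \<open>sums_inverse_theta\<close> at \<open>u = e\<^sup>t / q\<^sup>N\<close> are integrated over
  \<open>[0, L)\<close>. As \<open>N\<close> grows, the left side exhausts the real line with weights tending to
  \<open>1 / (q; q)\<^sub>\<infinity>\<close>.\<close>

lemma nn_integral_inverse_theta:
  "(\<integral>\<^sup>+t. ennreal (1 / theta (exp t)) \<partial>lborel) = ennreal (L * A (- q))"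
proof -
  note [measurable] = measurable_inverse_theta
  define v where "v = (\<lambda>t. 1 / theta (exp t))"
  have [measurable]: "v \<in> borel_measurable borel" unfolding v_def by measurable
  have v: "v t > 0" for t using theta_pos[of "exp t"] by (simp add: v_def)
  \<comment> \<open>For fixed \<open>N\<close>, \<open>\<phi> N k\<close> is the k-th term of the
    series moved back to its own window of length L. The windows tile the half-line t < (N + 1) L,
    so each such t sees exactly one k, and \<open>\<kappa> N t\<close> is the weight of that k, with
    0 beyond the tiles.\<close>
  define \<phi> where "\<phi> = (\<lambda>(N::nat) (k::nat) t.
    ennreal (euler_inv k * v t) * indicator {(real N - real k) * L..<(real N - real k + 1) * L} t)"
  define \<kappa> where "\<kappa> = (\<lambda>(N::nat) t::real. if \<lfloor>t / L\<rfloor> \<le> int N then euler_inv (nat (int N - \<lfloor>t / L\<rfloor>)) else 0)"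
  have ind: "t \<in> {(real N - real k) * L..<(real N - real k + 1) * L} \<longleftrightarrow> \<lfloor>t / L\<rfloor> = int N - int k" for t N k
    unfolding floor_eq_iff using L_pos by (auto simp: field_simps)
  have sum_\<phi>: "(\<Sum>k. \<phi> N k t) = ennreal (\<kappa> N t * v t)" for N t
  proof (cases "\<lfloor>t / L\<rfloor> \<le> int N")
    case True
    define k where "k = nat (int N - \<lfloor>t / L\<rfloor>)"
    have "\<lfloor>t / L\<rfloor> = int N - int j \<longleftrightarrow> j = k" for j
      using True by (auto simp: k_def)
    then have "\<phi> N j t = (if j = k then ennreal (euler_inv k * v t) else 0)" for j
      unfolding \<phi>_def indicator_def ind by simp
    then have "(\<Sum>j. \<phi> N j t) = (\<Sum>j\<in>{k}. ennreal (euler_inv k * v t))"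
      by (subst suminf_finite[of "{k}"]) auto
    then show ?thesis using True by (simp add: \<kappa>_def k_def)
  next
    case False
    then have "\<phi> N j t = 0" for j
      unfolding \<phi>_def indicator_def ind by simp
    then show ?thesis using False by (simp add: \<kappa>_def)
  qed
  have shift: "(\<integral>\<^sup>+t. \<phi> N k t \<partial>lborel) =
      (\<integral>\<^sup>+t. ennreal (euler_inv k / theta (q ^ k * exp (t + real N * L))) * indicator {0..<L} t \<partial>lborel)" for N k
  proof -
    have "(\<integral>\<^sup>+t. \<phi> N k t \<partial>lborel) =
        (\<integral>\<^sup>+t. \<phi> N k ((real N - real k) * L + 1 * t) \<partial>lborel)"
      unfolding \<phi>_def by (subst nn_integral_real_affine[where c = 1 and t = "(real N - real k) * L"]) auto
    also have "\<dots> = (\<integral>\<^sup>+t. ennreal (euler_inv k / theta (q ^ k * exp (t + real N * L))) * indicator {0..<L} t \<partial>lborel)"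
    proof (intro nn_integral_cong)
      fix t :: real
      have "indicator {(real N - real k) * L..<(real N - real k + 1) * L} ((real N - real k) * L + 1 * t)
          = (indicator {0..<L} t :: ennreal)"
        by (auto simp: indicator_def algebra_simps)
      moreover have "v ((real N - real k) * L + 1 * t) = 1 / theta (q ^ k * exp (t + real N * L))"
        unfolding v_def by (simp add: add.commute exp_add_mult_L)
      ultimately show "\<phi> N k ((real N - real k) * L + 1 * t) =
          ennreal (euler_inv k / theta (q ^ k * exp (t + real N * L))) * indicator {0..<L} t"
        by (simp add: \<phi>_def)
    qed
    finally show ?thesis .
  qed
  have eq: "(\<integral>\<^sup>+t. ennreal (\<kappa> N t * v t) \<partial>lborel) =
      (\<integral>\<^sup>+t. ennreal (1 / A (q / exp (t + real N * L))) * indicator {0..<L} t \<partial>lborel)" for N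
  proof -
    have [measurable]: "\<phi> N k \<in> borel_measurable lborel" for k
      unfolding \<phi>_def by measurable
    have m: "(\<lambda>t. ennreal (euler_inv k / theta (q ^ k * exp (t + real N * L))) * indicator {0..<L} t)
        \<in> borel_measurable lborel" for k
    proof -
      have "(\<lambda>t. ennreal (euler_inv k * (1 / theta (exp (t + (real N - real k) * L)))) * indicator {0..<L} t)
        \<in> borel_measurable lborel" by measurable
      then show ?thesis unfolding exp_add_mult_L by simp
    qed
    have "(\<integral>\<^sup>+t. ennreal (\<kappa> N t * v t) \<partial>lborel) = (\<Sum>k. \<integral>\<^sup>+t. \<phi> N k t \<partial>lborel)"
      unfolding sum_\<phi>[symmetric] by (rule nn_integral_suminf) measurable
    also have "\<dots> = (\<integral>\<^sup>+t. (\<Sum>k. ennreal (euler_inv k / theta (q ^ k * exp (t + real N * L))) * indicator {0..<L} t) \<partial>lborel)"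
      unfolding shift by (rule nn_integral_suminf[symmetric]) (rule m)
    also have "\<dots> = (\<integral>\<^sup>+t. ennreal (1 / A (q / exp (t + real N * L))) * indicator {0..<L} t \<partial>lborel)"
    proof (intro nn_integral_cong)
      fix t :: real
      have "(\<Sum>k. ennreal (euler_inv k / theta (q ^ k * exp (t + real N * L)))) = ennreal (1 / A (q / exp (t + real N * L)))"
        using theta_pos q_pos euler_inv_pos
        by (intro suminf_ennreal_eq sums_inverse_theta) (auto intro!: divide_nonneg_nonneg less_imp_le)
      then show "(\<Sum>k. ennreal (euler_inv k / theta (q ^ k * exp (t + real N * L))) * indicator {0..<L} t) =
          ennreal (1 / A (q / exp (t + real N * L))) * indicator {0..<L} t"
        by (simp add: ennreal_suminf_multc)
    qed
    finally show ?thesis .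
  qed
  have NL: "filterlim (\<lambda>N. t + real N * L) at_top sequentially" for t
    by (intro filterlim_tendsto_add_at_top[OF tendsto_const]
        filterlim_at_top_mult_tendsto_pos[OF tendsto_const L_pos] filterlim_real_sequentially)
  \<comment> \<open>The argument q / e^(t + NL) of \<open>A\<close> tends to 0 and \<open>A\<close>
    to 1; since \<open>A\<close> is at least 1 there, the indicator of [0, L) dominates.\<close>
  have lim1: "(\<lambda>N. \<integral>\<^sup>+t. ennreal (1 / A (q / exp (t + real N * L))) * indicator {0..<L} t \<partial>lborel)
      \<longlonglongrightarrow> (\<integral>\<^sup>+t. ennreal 1 * indicator {0..<L} t \<partial>lborel)"
  proof (rule nn_integral_dominated_convergence[where w = "indicator {0..<L}"])
    show "(\<lambda>t. ennreal (1 / A (q / exp (t + real N * L))) * indicator {0..<L} t) \<in> borel_measurable lborel" for N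
    proof -
      have "(\<lambda>t. 1 / A (q / exp (t + real N * L))) \<in> borel_measurable borel"
        using A_pos[of "q / exp _"] q_pos
        by (intro borel_measurable_continuous_onI continuous_intros) (auto simp: less_imp_neq[THEN not_sym])
      then show ?thesis by measurable
    qed
    show "AE t in lborel. ennreal (1 / A (q / exp (t + real N * L))) * indicator {0..<L} t \<le> indicator {0..<L} t" for N
    proof (intro AE_I2)
      fix t :: real
      have "A (q / exp (t + real N * L)) \<ge> 1" using q_pos by (intro A_ge_1) simp
      then show "ennreal (1 / A (q / exp (t + real N * L))) * indicator {0..<L} t \<le> indicator {0..<L} t"
        by (simp add: indicator_def)
    qed
    show "(\<integral>\<^sup>+t. indicator {0..<L} t \<partial>lborel) < \<infinity>" using L_pos by simp
    show "AE t in lborel. (\<lambda>N. ennreal (1 / A (q / exp (t + real N * L))) * indicator {0..<L} t)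
        \<longlonglongrightarrow> ennreal 1 * indicator {0..<L} t"
    proof (intro AE_I2)
      fix t :: real
      have "(\<lambda>N. q / exp (t + real N * L)) \<longlonglongrightarrow> 0"
        by (intro tendsto_divide_0[OF tendsto_const] filterlim_at_top_imp_at_infinity
            filterlim_compose[OF exp_at_top NL])
      then have "(\<lambda>N. A (q / exp (t + real N * L))) \<longlonglongrightarrow> A 0"
        unfolding A_def by (intro tendsto_intros tendsto_P)
      moreover have "A 0 = 1" by (simp add: A_def)
      ultimately have "(\<lambda>N. 1 / A (q / exp (t + real N * L))) \<longlonglongrightarrow> 1 / 1"
        by (intro tendsto_intros) auto
      then show "(\<lambda>N. ennreal (1 / A (q / exp (t + real N * L))) * indicator {0..<L} t)
        \<longlonglongrightarrow> ennreal 1 * indicator {0..<L} t"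
        using tendsto_ennrealI[of _ "1 / 1 :: real"] by (cases "t \<in> {0..<L}") fastforce+
    qed
    show "indicator {0..<L} \<in> borel_measurable lborel" by measurable
  qed simp
  \<comment> \<open>Monotone convergence: raising N by one raises the index of
    \<open>euler_inv\<close> at a fixed t by one, and \<open>euler_inv\<close> increases to
    1/(q;q)_inf.\<close>
  have lim2: "(\<lambda>N. \<integral>\<^sup>+t. ennreal (\<kappa> N t * v t) \<partial>lborel) \<longlonglongrightarrow> (\<integral>\<^sup>+t. ennreal (1 / A (- q) * v t) \<partial>lborel)"
  proof (rule nn_integral_LIMSEQ)
    show "incseq (\<lambda>N t. ennreal (\<kappa> N t * v t))"
    proof (intro incseq_SucI le_funI ennreal_leI mult_right_mono less_imp_le[OF v])
      fix N and t :: real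
      show "\<kappa> N t \<le> \<kappa> (Suc N) t"
      proof (cases "\<lfloor>t / L\<rfloor> \<le> int N")
        case True
        then have "nat (int (Suc N) - \<lfloor>t / L\<rfloor>) = Suc (nat (int N - \<lfloor>t / L\<rfloor>))" by simp
        then show ?thesis using True euler_inv_Suc_le by (simp add: \<kappa>_def)
      next
        case False
        then show ?thesis using euler_inv_pos by (simp add: \<kappa>_def less_imp_le)
      qed
    qed
    show "(\<lambda>t. ennreal (\<kappa> N t * v t)) \<in> borel_measurable lborel" for N
      unfolding \<kappa>_def by measurable
    show "(\<lambda>N. ennreal (\<kappa> N t * v t)) \<longlonglongrightarrow> ennreal (1 / A (- q) * v t)" for t
    proof (intro tendsto_ennrealI tendsto_mult tendsto_const)
      have "eventually (\<lambda>N. euler_inv (nat (int N - \<lfloor>t / L\<rfloor>)) = \<kappa> N t) sequentially"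
        using eventually_ge_at_top[of "nat \<lfloor>t / L\<rfloor>"] by eventually_elim (auto simp: \<kappa>_def)
      moreover have "filterlim (\<lambda>N. nat (int N - \<lfloor>t / L\<rfloor>)) at_top sequentially"
        unfolding filterlim_at_top_ge[where c = 0] eventually_sequentially
        by (intro allI impI, rule_tac x = "nat (int Z + \<lfloor>t / L\<rfloor>)" in exI) auto
      then have "(\<lambda>N. euler_inv (nat (int N - \<lfloor>t / L\<rfloor>))) \<longlonglongrightarrow> 1 / A (- q)"
        by (rule filterlim_compose[OF euler_inv_tendsto])
      ultimately show "(\<lambda>N. \<kappa> N t) \<longlonglongrightarrow> 1 / A (- q)"
        by (rule Lim_transform_eventually[rotated])
    qed
  qed
  have "(\<integral>\<^sup>+t. ennreal (1 / A (- q) * v t) \<partial>lborel) = ennreal L"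
    using LIMSEQ_unique[OF lim2 lim1[folded eq]] L_pos by simp
  then have "ennreal (A (- q)) * (\<integral>\<^sup>+t. ennreal (1 / A (- q) * v t) \<partial>lborel) = ennreal (A (- q)) * ennreal L"
    by simp
  then have "(\<integral>\<^sup>+t. ennreal (A (- q)) * ennreal (1 / A (- q) * v t) \<partial>lborel) = ennreal (A (- q) * L)"
    using L_pos A_neg_q_pos by (subst nn_integral_cmult) (auto simp: ennreal_mult)
  then show ?thesis
    using A_neg_q_pos v by (simp add: v_def ennreal_mult[symmetric] less_imp_le mult.commute)
qed

text \<open>With y = e^(2t) one has 1/D = (1 + y)/theta(y) = 1/theta(y) + 1/theta(qy). After the
  substitution s = 2t, each of the two terms contributes half of the integral of 1/theta.\<close>

lemma integral_inverse_D: "has_bochner_integral lborel (\<lambda>t. 1 / D (exp t)) (L * A (- q))"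
proof (rule has_bochner_integral_nn_integral)
  note [measurable] = measurable_inverse_theta
  show "(\<lambda>t. 1 / D (exp t)) \<in> borel_measurable lborel"
    unfolding measurable_lborel2 using D_nonzero
    by (intro borel_measurable_continuous_onI continuous_intros continuous_on_D) auto
  show "AE t in lborel. 0 \<le> 1 / D (exp t)"
    using D_pos[of "exp _"] by (auto intro!: AE_I2 less_imp_le)
  show "0 \<le> L * A (- q)" using L_pos A_neg_q_pos by simp
  have eq: "1 / D (exp t) = 1 / theta (exp (0 + 2 * t)) + 1 / theta (exp (- L + 2 * t))" for t
  proof -
    define y where "y = (exp t)\<^sup>2"
    have y: "y > 0" by (simp add: y_def)
    have e: "exp (0 + 2 * t) = y" "exp (- L + 2 * t) = q * y"
      using exp_diff_L[of "2 * t"] by (simp_all add: y_def exp_double)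
    have "A y = (1 + y) * A (q * y)" by (rule A_shift)
    then have th: "theta y = (1 + y) * D (exp t)" by (simp add: theta_def D_def y_def)
    have "1 / theta y + 1 / theta (q * y) = (1 + y) / theta y"
      using theta_q_mult[OF y] by (simp add: add_divide_distrib)
    then show ?thesis unfolding e using th y by simp
  qed
  have half: "(\<integral>\<^sup>+t. ennreal (1 / theta (exp (s + 2 * t))) \<partial>lborel) = ennreal (1 / 2) * ennreal (L * A (- q))" for s
  proof -
    have "ennreal (L * A (- q)) = ennreal 2 * (\<integral>\<^sup>+t. ennreal (1 / theta (exp (s + 2 * t))) \<partial>lborel)"
      unfolding nn_integral_inverse_theta[symmetric]
      by (subst nn_integral_real_affine[where c = 2 and t = s]) auto
    then have "ennreal (1 / 2) * ennreal (L * A (- q)) =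
        ennreal (1 / 2) * ennreal 2 * (\<integral>\<^sup>+t. ennreal (1 / theta (exp (s + 2 * t))) \<partial>lborel)"
      by (simp add: mult.assoc)
    moreover have "ennreal (1 / 2) * ennreal 2 = 1"
      by (simp only: ennreal_mult[symmetric]) simp
    ultimately show ?thesis by simp
  qed
  have "(\<integral>\<^sup>+t. ennreal (1 / D (exp t)) \<partial>lborel) =
      (\<integral>\<^sup>+t. ennreal (1 / theta (exp (0 + 2 * t))) + ennreal (1 / theta (exp (- L + 2 * t))) \<partial>lborel)"
    unfolding eq using theta_pos[of "exp _"] by (intro nn_integral_cong ennreal_plus) (auto intro: less_imp_le)
  also have "\<dots> = (\<integral>\<^sup>+t. ennreal (1 / theta (exp (0 + 2 * t))) \<partial>lborel)
      + (\<integral>\<^sup>+t. ennreal (1 / theta (exp (- L + 2 * t))) \<partial>lborel)"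
    by (intro nn_integral_add) measurable
  also have "\<dots> = ennreal (1 / 2) * ennreal (L * A (- q)) + ennreal (1 / 2) * ennreal (L * A (- q))"
    by (simp only: half)
  also have "ennreal (1 / 2) * ennreal (L * A (- q)) = ennreal (L * A (- q) / 2)"
    using L_pos A_neg_q_pos by (subst ennreal_mult[symmetric]) auto
  also have "ennreal (L * A (- q) / 2) + ennreal (L * A (- q) / 2) = ennreal (L * A (- q) / 2 + L * A (- q) / 2)"
    using L_pos A_neg_q_pos by (intro ennreal_plus[symmetric]) auto
  also have "L * A (- q) / 2 + L * A (- q) / 2 = L * A (- q)" by simp
  finally show "(\<integral>\<^sup>+t. ennreal (1 / D (exp t)) \<partial>lborel) = ennreal (L * A (- q))" .
qed


subsection \<open>Askey's integral\<close>

definition I :: "complex \<Rightarrow> complex \<Rightarrow> complex \<Rightarrow> complex \<Rightarrow> complex" where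
  "I a b c d = (LINT t|lborel. W a b c d (exp t))"

lemma theta_sq_eq: "theta (u\<^sup>2) = (1 + u\<^sup>2) * D u"
  unfolding theta_def D_def by (subst A_shift) simp

text \<open>The factor \<open>u\<^sup>3\<close> is the one power of \<open>u\<close> for which \<open>1 + u\<^sup>2\<close> cancels in the difference
  \<open>g_shift u - g_shift (u / q)\<close>.\<close>

definition g_shift :: "complex \<Rightarrow> complex \<Rightarrow> complex \<Rightarrow> complex \<Rightarrow> real \<Rightarrow> complex" where
  "g_shift a b c d u = of_real (u ^ 3) * ((1 + \<i> * a / of_real u) * (1 + \<i> * b / of_real u)
     * (1 + \<i> * c / of_real u) * (1 + \<i> * d / of_real u)) * W a b c d u / of_real (1 + u\<^sup>2)"

text \<open>Explains the factors 1 + ip/u in \<open>g_shift\<close>: translation turns them into the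
  polynomials 1 - ipu and leaves \<open>H p u\<close> itself unchanged.\<close>

lemma H_shift:
  assumes "u > 0"
  shows "(1 + \<i> * p / of_real (u / q)) * H p (u / q) = (1 - \<i> * p * of_real u) * H p u"
proof -
  let ?q = "complex_of_real q" and ?u = "complex_of_real u"
  have "H p (u / q) = P (\<i> * p * ?u) * P (- \<i> * p / ?u * ?q * ?q)"
    using q_pos assms by (simp add: H_def field_simps)
  moreover have "P (\<i> * p * ?u) = (1 - \<i> * p * ?u) * P (\<i> * ?q * p * ?u)"
    by (subst P_shift) (simp add: mult_ac)
  moreover have "P (- \<i> * ?q * p / ?u) = (1 + \<i> * p / of_real (u / q)) * P (- \<i> * p / ?u * ?q * ?q)"
    using assms q_pos by (subst P_shift) (simp add: field_simps)
  ultimately show ?thesis by (simp add: H_def mult_ac)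
qed

text \<open>Two applications of the quasi-periodicity of theta lead from (u/q)^2 to u^2; 1 + u^2 is
  the ratio of theta(u^2) to D(u).\<close>

lemma D_shift':
  assumes "u > 0"
  shows "(1 + (u / q)\<^sup>2) * D (u / q) = (1 + u\<^sup>2) * D u * (u ^ 4 / q ^ 3)"
proof -
  have "theta (q * (u\<^sup>2 / q)) = theta (u\<^sup>2 / q) / (u\<^sup>2 / q)"
    using assms q_pos by (intro theta_q_mult) simp
  moreover have "theta (q * ((u / q)\<^sup>2)) = theta ((u / q)\<^sup>2) / (u / q)\<^sup>2"
    using assms q_pos by (intro theta_q_mult) simp
  moreover have "q * (u / q)\<^sup>2 = u\<^sup>2 / q" "q * (u\<^sup>2 / q) = u\<^sup>2"
    using q_pos by (simp_all add: field_simps power2_eq_square)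
  ultimately have "theta (u\<^sup>2) = theta ((u / q)\<^sup>2) / (u / q)\<^sup>2 / (u\<^sup>2 / q)" by simp
  then have "theta ((u / q)\<^sup>2) = theta (u\<^sup>2) * (u\<^sup>2 / q * (u / q)\<^sup>2)"
    using assms q_pos by simp
  also have "u\<^sup>2 / q * (u / q)\<^sup>2 = u ^ 4 / q ^ 3"
    by (simp add: power_divide power2_eq_square power3_eq_cube power4_eq_xxxx)
  finally show ?thesis unfolding theta_sq_eq .
qed

text \<open>The product of the u + ip and the product of the 1 - ipu, over p = a, b, c, d, agree at
  u = i and u = -i. Their difference is therefore divisible by 1 + u^2, and the quotient divided by
  u is a combination of u - 1/u and a constant.\<close>

lemma g_shift_diff:
  assumes u: "u > 0"
  shows "g_shift a b c d u - g_shift a b c d (u / q) = W a b c d u *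
    ((1 - a * b * c * d) * of_real (u - 1 / u) + \<i> * (a + b + c + d - (a*b*c + a*b*d + a*c*d + b*c*d)))"
proof -
  let ?u = "complex_of_real u"
  have u0: "?u \<noteq> 0" and D0: "complex_of_real (D u) \<noteq> 0" using u D_nonzero[OF u] by auto
  have "1 + u\<^sup>2 > 0" using zero_le_power2[of u] by linarith
  then have s0: "complex_of_real (1 + u\<^sup>2) \<noteq> 0" by (simp only: of_real_eq_0_iff)
  have g1: "g_shift a b c d u = W a b c d u / of_real (1 + u\<^sup>2) * (?u ^ 3 * ((1 + \<i> * a / ?u) * (1 + \<i> * b / ?u)
     * (1 + \<i> * c / ?u) * (1 + \<i> * d / ?u)))"
    by (simp add: g_shift_def)
  have "g_shift a b c d (u / q) = of_real ((u / q) ^ 3) * (((1 + \<i> * a / of_real (u / q)) * H a (u / q))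
      * ((1 + \<i> * b / of_real (u / q)) * H b (u / q)) * ((1 + \<i> * c / of_real (u / q)) * H c (u / q))
      * ((1 + \<i> * d / of_real (u / q)) * H d (u / q))) / of_real ((1 + (u / q)\<^sup>2) * D (u / q))"
    by (simp add: g_shift_def W_def mult_ac)
  also have "\<dots> = of_real ((u / q) ^ 3 / (u ^ 4 / q ^ 3)) * (W a b c d u / of_real (1 + u\<^sup>2) * ((1 - \<i> * a * ?u) * (1 - \<i> * b * ?u)
      * (1 - \<i> * c * ?u) * (1 - \<i> * d * ?u)))"
    unfolding H_shift[OF u] D_shift'[OF u] by (simp add: W_def mult_ac)
  also have "(u / q) ^ 3 / (u ^ 4 / q ^ 3) = 1 / u"
    using u q_pos by (simp add: power_divide field_simps power3_eq_cube power4_eq_xxxx)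
  finally have g2: "g_shift a b c d (u / q) = W a b c d u / of_real (1 + u\<^sup>2) * (1 / ?u * ((1 - \<i> * a * ?u) * (1 - \<i> * b * ?u)
      * (1 - \<i> * c * ?u) * (1 - \<i> * d * ?u)))" by simp
  have "?u ^ 3 * ((1 + \<i> * a / ?u) * (1 + \<i> * b / ?u) * (1 + \<i> * c / ?u) * (1 + \<i> * d / ?u)) =
      (?u + \<i> * a) * (?u + \<i> * b) * (?u + \<i> * c) * (?u + \<i> * d) / ?u"
    using u0 by (simp add: field_simps power3_eq_cube)
  moreover have "(?u + \<i> * a) * (?u + \<i> * b) * (?u + \<i> * c) * (?u + \<i> * d) -
      (1 - \<i> * a * ?u) * (1 - \<i> * b * ?u) * (1 - \<i> * c * ?u) * (1 - \<i> * d * ?u) =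
      (1 + ?u\<^sup>2) * ((1 - a * b * c * d) * (?u\<^sup>2 - 1) + \<i> * (a + b + c + d - (a*b*c + a*b*d + a*c*d + b*c*d)) * ?u)"
  proof -
    have i: "\<i> * \<i> = -1" by simp
    \<comment> \<open>The imaginary unit is replaced by a variable with square -1, which makes this
      a polynomial identity modulo one relation.\<close>
    have "(u + i * a) * (u + i * b) * (u + i * c) * (u + i * d) -
      (1 - i * a * u) * (1 - i * b * u) * (1 - i * c * u) * (1 - i * d * u) =
      (1 + u\<^sup>2) * ((1 - a * b * c * d) * (u\<^sup>2 - 1) + i * (a + b + c + d - (a*b*c + a*b*d + a*c*d + b*c*d)) * u)"
      if "i * i = -1" for i u :: complex
      using that by algebra
    from this[OF i] show ?thesis .
  qed
  ultimately have "?u ^ 3 * ((1 + \<i> * a / ?u) * (1 + \<i> * b / ?u) * (1 + \<i> * c / ?u) * (1 + \<i> * d / ?u))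
      - 1 / ?u * ((1 - \<i> * a * ?u) * (1 - \<i> * b * ?u) * (1 - \<i> * c * ?u) * (1 - \<i> * d * ?u)) =
      of_real (1 + u\<^sup>2) * ((1 - a * b * c * d) * (?u\<^sup>2 - 1) + \<i> * (a + b + c + d - (a*b*c + a*b*d + a*c*d + b*c*d)) * ?u) / ?u"
    by (simp add: diff_divide_distrib[symmetric])
  then have "g_shift a b c d u - g_shift a b c d (u / q) = W a b c d u / of_real (1 + u\<^sup>2) *
      (of_real (1 + u\<^sup>2) * ((1 - a * b * c * d) * (?u\<^sup>2 - 1) + \<i> * (a + b + c + d - (a*b*c + a*b*d + a*c*d + b*c*d)) * ?u) / ?u)"
    unfolding g1 g2 right_diff_distrib[symmetric] by simp
  also have "\<dots> = W a b c d u * (((1 - a * b * c * d) * (?u\<^sup>2 - 1) + \<i> * (a + b + c + d - (a*b*c + a*b*d + a*c*d + b*c*d)) * ?u) / ?u)"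
    using s0 by simp
  also have "((1 - a * b * c * d) * (?u\<^sup>2 - 1) + \<i> * (a + b + c + d - (a*b*c + a*b*d + a*c*d + b*c*d)) * ?u) / ?u =
      (1 - a * b * c * d) * of_real (u - 1 / u) + \<i> * (a + b + c + d - (a*b*c + a*b*d + a*c*d + b*c*d))"
    using u0 by (simp add: field_simps power2_eq_square)
  finally show ?thesis .
qed

text \<open>After each 1 + |p|/u is bounded by (1 + |p|)(1 + 1/u), the powers of u left over are (1
  + u)^4 / (u (1 + u^2)). The constant 4 comes from squaring (1 + u)^2 <= 2 (1 + u^2).\<close>

lemma norm_g_shift_le:
  assumes u: "u > 0"
  shows "norm (g_shift a b c d u) \<le> 4 * ((1 + norm a) * (1 + norm b) * (1 + norm c) * (1 + norm d)) *
    (M (norm a) (norm b) (norm c) (norm d) u * (u + 1 / u))"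
proof -
  let ?C = "(1 + norm a) * (1 + norm b) * (1 + norm c) * (1 + norm d)"
  have f: "norm (1 + \<i> * p / of_real u) \<le> (1 + norm p) * (1 + 1 / u)" for p :: complex
  proof -
    have "norm (1 + \<i> * p / of_real u) \<le> 1 + norm p / u"
      using norm_triangle_ineq[of 1 "\<i> * p / of_real u"] u by (simp add: norm_mult norm_divide)
    also have "\<dots> \<le> (1 + norm p) * (1 + 1 / u)" using u by (simp add: field_simps)
    finally show ?thesis .
  qed
  have s: "1 + u\<^sup>2 > 0" using zero_le_power2[of u] by linarith
  have "norm (g_shift a b c d u) = u ^ 3 * (norm (1 + \<i> * a / of_real u) * norm (1 + \<i> * b / of_real u)
     * norm (1 + \<i> * c / of_real u) * norm (1 + \<i> * d / of_real u)) * norm (W a b c d u) / (1 + u\<^sup>2)"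
    using u s unfolding g_shift_def norm_mult norm_divide norm_of_real by (simp add: norm_power)
  also have "\<dots> \<le> u ^ 3 * (((1 + norm a) * (1 + 1 / u)) * ((1 + norm b) * (1 + 1 / u)) * ((1 + norm c) * (1 + 1 / u))
      * ((1 + norm d) * (1 + 1 / u))) * M (norm a) (norm b) (norm c) (norm d) u / (1 + u\<^sup>2)"
    using u s by (intro divide_right_mono mult_mono order_refl f norm_W_le mult_nonneg_nonneg norm_ge_zero) auto
  also have "\<dots> = ?C * M (norm a) (norm b) (norm c) (norm d) u * (u ^ 3 * (1 + 1 / u) ^ 4 / (1 + u\<^sup>2))"
    by (simp add: power4_eq_xxxx mult_ac)
  also have "\<dots> \<le> ?C * M (norm a) (norm b) (norm c) (norm d) u * (4 * (u + 1 / u))"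
  proof (intro mult_left_mono mult_nonneg_nonneg M_nonneg u)
    have "(1 + u)\<^sup>2 \<le> 2 * (1 + u\<^sup>2)"
      using sum_squares_bound[of 1 u] by (simp add: power2_sum)
    then have "((1 + u)\<^sup>2)\<^sup>2 \<le> (2 * (1 + u\<^sup>2))\<^sup>2" by (intro power_mono) auto
    then have "(1 + u) ^ 4 \<le> 4 * (1 + u\<^sup>2)\<^sup>2" unfolding power_mult_distrib by (simp flip: power_mult)
    then have "(1 + u) ^ 4 / (u * (1 + u\<^sup>2)) \<le> 4 * (1 + u\<^sup>2)\<^sup>2 / (u * (1 + u\<^sup>2))"
      using u s by (intro divide_right_mono) auto
    moreover have "4 * (1 + u\<^sup>2)\<^sup>2 / (u * (1 + u\<^sup>2)) = 4 * (u + 1 / u)"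
    proof -
      have "4 * (1 + u\<^sup>2)\<^sup>2 / (u * (1 + u\<^sup>2)) = 4 * (1 + u\<^sup>2) / u"
        using u s by (simp add: power2_eq_square[of "1 + u\<^sup>2"])
      then show ?thesis using u by (simp add: field_simps power2_eq_square)
    qed
    moreover have "u ^ 3 * (1 + 1 / u) ^ 4 = (1 + u) ^ 4 / u"
    proof -
      have "1 + 1 / u = (1 + u) / u" using u by (simp add: field_simps)
      then show ?thesis using u by (simp add: power_divide power3_eq_cube power4_eq_xxxx)
    qed
    ultimately show "u ^ 3 * (1 + 1 / u) ^ 4 / (1 + u\<^sup>2) \<le> 4 * (u + 1 / u)" by simp
  qed auto
  also have "\<dots> = 4 * ?C * (M (norm a) (norm b) (norm c) (norm d) u * (u + 1 / u))"
    by (simp only: mult_ac)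
  finally show ?thesis .
qed

lemma integrable_g_shift:
  assumes "norm (a * b * c * d) < 1"
  shows "integrable lborel (\<lambda>t. g_shift a b c d (exp t))"
proof (rule Bochner_Integration.integrable_bound)
  show "integrable lborel (\<lambda>t. 4 * ((1 + norm a) * (1 + norm b) * (1 + norm c) * (1 + norm d)) *
    (M (norm a) (norm b) (norm c) (norm d) (exp t) * (exp t + 1 / exp t)))"
    using assms by (intro integrable_mult_right integrable_M_cosh) (auto simp: norm_mult)
  show "(\<lambda>t. g_shift a b c d (exp t)) \<in> borel_measurable lborel"
    unfolding g_shift_def by measurable
  show "AE t in lborel. norm (g_shift a b c d (exp t)) \<le>
     norm (4 * ((1 + norm a) * (1 + norm b) * (1 + norm c) * (1 + norm d)) *
    (M (norm a) (norm b) (norm c) (norm d) (exp t) * (exp t + 1 / exp t)))"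
    using norm_g_shift_le[of "exp _" a b c d] by (auto intro!: AE_I2 order_trans[OF _ abs_ge_self])
qed

lemma integral_g_shift_diff:
  assumes "norm (a * b * c * d) < 1"
  shows "has_bochner_integral lborel (\<lambda>t. W a b c d (exp t) *
    ((1 - a * b * c * d) * of_real (exp t - 1 / exp t) + \<i> * (a + b + c + d - (a*b*c + a*b*d + a*c*d + b*c*d)))) 0"
proof -
  have 1: "integrable lborel (\<lambda>t. g_shift a b c d (exp t))" by (rule integrable_g_shift[OF assms])
  have 2: "integrable lborel (\<lambda>t. g_shift a b c d (exp (L + 1 * t)))"
    by (rule lborel_integrable_real_affine[OF 1]) simp
  have 3: "(LINT t|lborel. g_shift a b c d (exp (L + 1 * t))) = (LINT t|lborel. g_shift a b c d (exp t))"
    by (subst lborel_integral_real_affine[of 1 _ L]) auto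
  have "has_bochner_integral lborel (\<lambda>t. g_shift a b c d (exp t) - g_shift a b c d (exp (L + 1 * t))) 0"
    using has_bochner_integral_diff[OF has_bochner_integral_integrable[OF 1] has_bochner_integral_integrable[OF 2]]
    unfolding 3 by simp
  moreover have "exp (L + 1 * t) = exp t / q" for t using exp_add_L[of t] by (simp add: add.commute)
  ultimately show ?thesis by (simp only: g_shift_diff exp_gt_zero)
qed

lemma H_step: "H a u = (1 - \<i> * (of_real q * a) * of_real u) * (1 + \<i> * (of_real q * a) / of_real u) * H (of_real q * a) u"
proof -
  have "P (\<i> * of_real q * a * of_real u) = (1 - \<i> * (of_real q * a) * of_real u) * P (\<i> * of_real q * (of_real q * a) * of_real u)"
    by (subst P_shift) (simp add: mult_ac)
  moreover have "P (- \<i> * of_real q * a / of_real u) = (1 + \<i> * (of_real q * a) / of_real u) * P (- \<i> * of_real q * (of_real q * a) / of_real u)"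
    by (subst P_shift) (simp add: mult_ac)
  ultimately show ?thesis by (simp add: H_def mult_ac)
qed

text \<open>With s = i (u - 1/u) the integrand at a is 1 - a's + a'^2 times the integrand at a'. The
  combination of the two in the claim is then a multiple of the translation difference of g at (a',
  b, c, d), whose integral is 0.\<close>

lemma I_step:
  fixes a b c d :: complex
  defines "a' \<equiv> of_real q * a"
  assumes n: "norm (a' * b * c * d) < 1"
  shows "(1 - a' * b * c * d) * I a b c d = (1 - a' * b) * (1 - a' * c) * (1 - a' * d) * I a' b c d"
proof -
  have "norm (of_real q * (a' * b * c * d)) \<le> 1 * norm (a' * b * c * d)"
    unfolding norm_mult[of "of_real q"] using q_pos q_less by (intro mult_right_mono) auto
  then have i2: "integrable lborel (\<lambda>t. W a' b c d (exp t))"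
    using n by (intro integrable_W) (simp add: mult.assoc)
  have i1: "integrable lborel (\<lambda>t. W a b c d (exp t))"
    using n by (intro integrable_W) (simp add: a'_def)
  have eq: "(1 - a' * b * c * d) * W a b c d u - (1 - a' * b) * (1 - a' * c) * (1 - a' * d) * W a' b c d u =
    - a' * \<i> * (W a' b c d u * ((1 - a' * b * c * d) * of_real (u - 1 / u) +
        \<i> * (a' + b + c + d - (a'*b*c + a'*b*d + a'*c*d + b*c*d))))" if u: "u > 0" for u
  proof -
    define s where "s = \<i> * complex_of_real (u - 1 / u)"
    have "(1 - \<i> * a' * of_real u) * (1 + \<i> * a' / of_real u) = 1 - a' * s + a'\<^sup>2"
      using u by (simp add: s_def field_simps power2_eq_square)
    then have W: "W a b c d u = (1 - a' * s + a'\<^sup>2) * W a' b c d u"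
      unfolding W_def H_step[of a] a'_def[symmetric] by simp
    have "(1 - a' * b * c * d) * ((1 - a' * s + a'\<^sup>2) * w) - (1 - a' * b) * (1 - a' * c) * (1 - a' * d) * w =
        - a' * (w * ((1 - a' * b * c * d) * s - (a' + b + c + d - (a'*b*c + a'*b*d + a'*c*d + b*c*d))))" for w
      by algebra
    moreover have "\<i> * ((1 - a' * b * c * d) * of_real (u - 1 / u) + \<i> * e) = (1 - a' * b * c * d) * s - e" for e
      by (simp add: s_def algebra_simps)
    ultimately show ?thesis unfolding W mult.assoc[of "- a'"] mult.left_commute[of \<i>] by simp
  qed
  have "(1 - a' * b * c * d) * I a b c d - (1 - a' * b) * (1 - a' * c) * (1 - a' * d) * I a' b c d =
      (LINT t|lborel. (1 - a' * b * c * d) * W a b c d (exp t) - (1 - a' * b) * (1 - a' * c) * (1 - a' * d) * W a' b c d (exp t))"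
    unfolding I_def using i1 i2 by simp
  also have "\<dots> = - a' * \<i> * 0"
    unfolding eq[OF exp_gt_zero]
    by (intro has_bochner_integral_integral_eq has_bochner_integral_mult_right integral_g_shift_diff n)
  finally show ?thesis by simp
qed

lemma I_iterate:
  assumes "norm (of_real q * a * b * c * d) < 1"
  shows "qpoch q (of_real q * a * b * c * d) n * I a b c d =
    qpoch q (of_real q * a * b) n * qpoch q (of_real q * a * c) n * qpoch q (of_real q * a * d) n
      * I (a * of_real q ^ n) b c d"
proof (induction n)
  case (Suc n)
  define a' where "a' = of_real q * (a * of_real q ^ n)"
  have e: "of_real q * a * b * c * d * of_real q ^ n = a' * b * c * d"
    "of_real q * a * b * of_real q ^ n = a' * b" "of_real q * a * c * of_real q ^ n = a' * c"
    "of_real q * a * d * of_real q ^ n = a' * d" "a * of_real q ^ Suc n = a'"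
    by (simp_all add: a'_def mult_ac)
  have n: "norm (a' * b * c * d) < 1"
    unfolding e(1)[symmetric] by (rule norm_mult_q_power_less_1[OF assms])
  have step: "(1 - a' * b * c * d) * I (a * of_real q ^ n) b c d =
      (1 - a' * b) * (1 - a' * c) * (1 - a' * d) * I a' b c d"
    using n unfolding a'_def by (rule I_step)
  have "qpoch q (of_real q * a * b * c * d) (Suc n) * I a b c d =
      (1 - a' * b * c * d) * (qpoch q (of_real q * a * b * c * d) n * I a b c d)"
    unfolding qpoch_Suc e by (simp add: mult_ac)
  also have "\<dots> = qpoch q (of_real q * a * b) n * qpoch q (of_real q * a * c) n * qpoch q (of_real q * a * d) n
      * ((1 - a' * b * c * d) * I (a * of_real q ^ n) b c d)"
    unfolding Suc by (simp add: mult_ac)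
  finally show ?case unfolding step unfolding qpoch_Suc e by (simp add: mult_ac)
qed simp

lemma I_limit:
  assumes n: "norm (of_real q * a * b * c * d) < 1"
  shows "(\<lambda>n. I (a * of_real q ^ n) b c d) \<longlonglongrightarrow> I 0 b c d"
  unfolding I_def
proof (rule integral_dominated_convergence)
  show "integrable lborel (\<lambda>t. M (norm a) (norm b) (norm c) (norm d) (exp t))"
    using n q_pos by (intro integrable_M) (auto simp: norm_mult)
  have "norm (a * of_real q ^ n) \<le> norm a" for n
    using q_pos q_less by (simp add: norm_mult norm_power mult_left_le power_le_one)
  then show "AE t in lborel. norm (W (a * of_real q ^ n) b c d (exp t)) \<le> M (norm a) (norm b) (norm c) (norm d) (exp t)" for n
    by (intro AE_I2 norm_W_le) auto
  show "AE t in lborel. (\<lambda>n. W (a * of_real q ^ n) b c d (exp t)) \<longlonglongrightarrow> W 0 b c d (exp t)"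
  proof (intro AE_I2)
    fix t :: real
    show "(\<lambda>n. W (a * of_real q ^ n) b c d (exp t)) \<longlonglongrightarrow> W 0 b c d (exp t)"
      unfolding W_def H_def using D_nonzero[of "exp t"]
      by (intro tendsto_intros tendsto_P qpow_tendsto_0) auto
  qed
qed simp_all

lemma I_reduce:
  assumes "norm (of_real q * a * b * c * d) < 1"
  shows "P (of_real q * a * b * c * d) * I a b c d =
    P (of_real q * a * b) * P (of_real q * a * c) * P (of_real q * a * d) * I 0 b c d"
proof (rule LIMSEQ_unique)
  show "(\<lambda>n. qpoch q (of_real q * a * b * c * d) n * I a b c d) \<longlonglongrightarrow> P (of_real q * a * b * c * d) * I a b c d"
    by (intro tendsto_intros qpoch_tendsto)
  show "(\<lambda>n. qpoch q (of_real q * a * b * c * d) n * I a b c d) \<longlonglongrightarrow>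
      P (of_real q * a * b) * P (of_real q * a * c) * P (of_real q * a * d) * I 0 b c d"
    unfolding I_iterate[OF assms] by (intro tendsto_intros qpoch_tendsto I_limit assms)
qed

lemma I_0: "I 0 0 0 0 = of_real L * P (of_real q)"
proof -
  have "W 0 0 0 0 u = of_real (1 / D u)" for u by (simp add: W_def H_def)
  then have "I 0 0 0 0 = of_real (LINT t|lborel. 1 / D (exp t))"
    unfolding I_def by (simp only: integral_complex_of_real)
  then show ?thesis
    using has_bochner_integral_integral_eq[OF integral_inverse_D] by (simp add: of_real_A_neg_q)
qed

text \<open>The integral is symmetric, so \<open>I_reduce\<close> removes each parameter in turn.
  Removing b leaves the factors for bc and bd, removing c the one for cd, and removing d none; once
  a = 0 the convergence condition is automatic.\<close>

lemma askey_integral: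
  assumes "norm (of_real q * a * b * c * d) < 1"
  shows "P (of_real q * a * b * c * d) * I a b c d =
    P (of_real q) * P (of_real q * a * b) * P (of_real q * a * c) * P (of_real q * a * d)
     * P (of_real q * b * c) * P (of_real q * b * d) * P (of_real q * c * d) * of_real L"
proof -
  have sym: "I a b c d = I b a c d" "I a b c d = I c b a d" "I a b c d = I d b c a" for a b c d
    by (simp_all add: I_def W_def mult_ac)
  have "I 0 b c d = P (of_real q * b * c) * P (of_real q * b * d) * I 0 0 c d"
    using I_reduce[of b 0 c d] sym(1)[of 0 b c d] by simp
  moreover have "I 0 0 c d = P (of_real q * c * d) * I 0 0 0 d"
    using I_reduce[of c 0 0 d] sym(2)[of 0 0 c d] by simp
  moreover have "I 0 0 0 d = I 0 0 0 0"
    using I_reduce[of d 0 0 0] sym(3)[of 0 0 0 d] by simp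
  ultimately show ?thesis
    unfolding I_reduce[OF assms] I_0 by (simp add: mult_ac)
qed

end

subsection \<open>Majorised power series\<close>

text \<open>\<open>K\<close> bounds the weighted l1-norm of the Taylor coefficients on the circle of
  radius \<open>R\<close>. This norm is submultiplicative and, for infinite products, explicitly
  computable through \<open>A\<close>.\<close>

definition powser_majorised :: "real \<Rightarrow> (complex \<Rightarrow> complex) \<Rightarrow> real \<Rightarrow> bool" where
  "powser_majorised R f K \<longleftrightarrow> (\<exists>c. (\<forall>y. norm y \<le> R \<longrightarrow> (\<lambda>n. c n * y ^ n) sums f y) \<and>
     summable (\<lambda>n. norm (c n) * R ^ n) \<and> (\<Sum>n. norm (c n) * R ^ n) \<le> K)"

lemma powser_majorised_mult:
  assumes f: "powser_majorised R f K" and g: "powser_majorised R g K'" and R: "R \<ge> 0"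
  shows "powser_majorised R (\<lambda>y. f y * g y) (K * K')"
proof -
  obtain c where c: "\<And>y. norm y \<le> R \<Longrightarrow> (\<lambda>n. c n * y ^ n) sums f y"
      "summable (\<lambda>n. norm (c n) * R ^ n)" "(\<Sum>n. norm (c n) * R ^ n) \<le> K"
    using f unfolding powser_majorised_def by blast
  obtain e where e: "\<And>y. norm y \<le> R \<Longrightarrow> (\<lambda>n. e n * y ^ n) sums g y"
      "summable (\<lambda>n. norm (e n) * R ^ n)" "(\<Sum>n. norm (e n) * R ^ n) \<le> K'"
    using g unfolding powser_majorised_def by blast
  have abs: "summable (\<lambda>n. norm (w n * y ^ n))"
    if "summable (\<lambda>n. norm (w n) * R ^ n)" "norm y \<le> R" for w :: "nat \<Rightarrow> complex" and y
    using that(2) by (intro summable_comparison_test'[OF that(1), of 0])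
      (auto simp: norm_mult norm_power intro!: mult_left_mono power_mono)
  have nn: "(\<Sum>n. norm (w n) * R ^ n) \<ge> 0" if "summable (\<lambda>n. norm (w n) * R ^ n)" for w :: "nat \<Rightarrow> complex"
    using R that by (intro suminf_nonneg) auto
  define p where "p = (\<lambda>n. \<Sum>i\<le>n. c i * e (n - i))"
  have p_sums: "(\<lambda>n. p n * y ^ n) sums (f y * g y)" if y: "norm y \<le> R" for y
  proof -
    have "(\<lambda>n. \<Sum>i\<le>n. (c i * y ^ i) * (e (n - i) * y ^ (n - i))) sums
        ((\<Sum>n. c n * y ^ n) * (\<Sum>n. e n * y ^ n))"
      by (intro Cauchy_product_sums abs c e y)
    moreover have "(c i * y ^ i) * (e (n - i) * y ^ (n - i)) = c i * e (n - i) * y ^ n" if "i \<le> n" for i n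
    proof -
      have "y ^ n = y ^ i * y ^ (n - i)" using that by (simp flip: power_add)
      then show ?thesis by (simp add: mult_ac)
    qed
    ultimately show ?thesis
      using c(1)[OF y] e(1)[OF y] by (simp add: p_def sums_iff sum_distrib_right cong: sum.cong_simp)
  qed
  have prod: "(\<lambda>n. \<Sum>i\<le>n. (norm (c i) * R ^ i) * (norm (e (n - i)) * R ^ (n - i))) sums
      ((\<Sum>n. norm (c n) * R ^ n) * (\<Sum>n. norm (e n) * R ^ n))"
    using c(2) e(2) R by (intro Cauchy_product_sums) (simp_all add: abs_mult)
  have le: "norm (p n) * R ^ n \<le> (\<Sum>i\<le>n. (norm (c i) * R ^ i) * (norm (e (n - i)) * R ^ (n - i)))" for n
  proof -
    have "norm (p n) * R ^ n \<le> (\<Sum>i\<le>n. norm (c i * e (n - i))) * R ^ n"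
      unfolding p_def using R by (intro mult_right_mono norm_sum) auto
    also have "\<dots> = (\<Sum>i\<le>n. (norm (c i) * R ^ i) * (norm (e (n - i)) * R ^ (n - i)))"
      unfolding sum_distrib_right
    proof (intro sum.cong refl)
      fix i assume "i \<in> {..n}"
      then have "R ^ n = R ^ i * R ^ (n - i)" by (simp flip: power_add)
      then show "norm (c i * e (n - i)) * R ^ n = (norm (c i) * R ^ i) * (norm (e (n - i)) * R ^ (n - i))"
        by (simp add: norm_mult mult_ac)
    qed
    finally show ?thesis .
  qed
  have sp: "summable (\<lambda>n. norm (p n) * R ^ n)"
    using R le by (intro summable_comparison_test'[OF sums_summable[OF prod], of 0]) (auto simp: abs_mult)
  have "(\<Sum>n. norm (p n) * R ^ n) \<le> (\<Sum>n. norm (c n) * R ^ n) * (\<Sum>n. norm (e n) * R ^ n)"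
    using suminf_le[OF le sp sums_summable[OF prod]] sums_unique[OF prod] by simp
  also have "\<dots> \<le> K * K'" using c e nn[OF c(2)] nn[OF e(2)] by (intro mult_mono) auto
  finally show ?thesis
    unfolding powser_majorised_def using p_sums sp by blast
qed

context nome
begin

lemma powser_majorised_P:
  assumes R: "R \<ge> 0" and w: "norm w \<le> w'"
  shows "powser_majorised R (\<lambda>y. P (w * y)) (A (w' * R))"
  unfolding powser_majorised_def
proof (intro exI conjI allI impI)
  have eq: "norm (complex_of_real (euler n) * w ^ n) * R ^ n = \<bar>euler n\<bar> * (norm w * R) ^ n" for n
    by (simp add: norm_mult norm_power power_mult_distrib)
  show "(\<lambda>n. of_real (euler n) * w ^ n * y ^ n) sums P (w * y)" for y
    using P_sums[of "w * y"] by (simp add: power_mult_distrib mult.assoc)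
  show "summable (\<lambda>n. norm (complex_of_real (euler n) * w ^ n) * R ^ n)"
    unfolding eq by (rule sums_summable[OF abs_euler_sums])
  show "(\<Sum>n. norm (complex_of_real (euler n) * w ^ n) * R ^ n) \<le> A (w' * R)"
    unfolding eq A_eq_suminf[symmetric] using R w by (intro A_mono mult_right_mono) auto
qed

text \<open>The mere existence of a bound suffices: these factors do not involve t.\<close>

lemma powser_majorised_inverse_P:
  assumes R: "R \<ge> 0" and w: "norm w * R < 1"
  shows "\<exists>K. powser_majorised R (\<lambda>y. 1 / P (w * y)) K"
  unfolding powser_majorised_def
proof (intro exI conjI allI impI)
  have "norm (w * of_real R) < 1" using R w by (simp add: norm_mult)
  then show "summable (\<lambda>n. norm (complex_of_real (euler_inv n) * w ^ n) * R ^ n)"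
    using summable_euler_inv[of "w * of_real R"] R
    by (simp add: norm_mult norm_power power_mult_distrib mult.assoc)
  fix y :: complex assume "norm y \<le> R"
  then have "norm w * norm y \<le> norm w * R" by (intro mult_left_mono) auto
  then have "norm (w * y) < 1" using w by (simp add: norm_mult)
  then show "(\<lambda>n. of_real (euler_inv n) * w ^ n * y ^ n) sums (1 / P (w * y))"
    using P_inverse_sums[of "w * y"] by (simp add: power_mult_distrib mult.assoc)
qed (rule order_refl)

subsection \<open>The terminating $q$-binomial theorem\<close>

text \<open>The coefficient that the parameter q^(-k) produces in the terminating series. It equals
  (-1)^j q^(j(j-1)/2 - kj) times the Gaussian binomial coefficient of k over j.\<close>

definition qbeta :: "nat \<Rightarrow> nat \<Rightarrow> complex" where
  "qbeta k j = qpoch q (1 / of_real q ^ k) j / qpoch q (of_real q) j"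

lemma qpoch_nonzero:
  assumes "\<And>i. c * of_real q ^ i \<noteq> 1"
  shows "qpoch q c n \<noteq> 0"
  using assms by (simp add: qpoch_def)

lemma qpoch_q_nonzero: "qpoch q (of_real q) n \<noteq> 0"
proof (rule qpoch_nonzero)
  fix i
  have "complex_of_real (q ^ Suc i) \<noteq> of_real 1"
    using q_Suc_less_1[of i] by (simp only: of_real_eq_iff)
  then show "complex_of_real q * complex_of_real q ^ i \<noteq> 1" by simp
qed

lemma qpoch_eq_0: "k < j \<Longrightarrow> qpoch q (1 / of_real q ^ k) j = 0"
  using q_pos by (auto simp: qpoch_def intro!: bexI[of _ k])

lemma qbeta_eq_0: "k < j \<Longrightarrow> qbeta k j = 0"
  by (simp add: qbeta_def qpoch_eq_0)

lemma qbeta_0 [simp]: "qbeta k 0 = 1"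
  by (simp add: qbeta_def)

text \<open>Pascal's rule in the form that multiplies the generating polynomial by 1 - z /
  q^(k+1).\<close>

lemma qbeta_Suc: "qbeta (Suc k) (Suc j) = qbeta k (Suc j) - qbeta k j / of_real q ^ Suc k"
proof -
  define X Y where "X = qpoch q (1 / complex_of_real q ^ k) j" and "Y = qpoch q (complex_of_real q) j"
  define r where "r = complex_of_real q"
  have r: "r \<noteq> 0" using q_pos by (simp add: r_def)
  have Y: "Y \<noteq> 0" "Y * (1 - r ^ Suc j) \<noteq> 0"
    using qpoch_q_nonzero[of j] qpoch_q_nonzero[of "Suc j"] by (simp_all add: Y_def r_def qpoch_Suc)
  then have r1: "1 - r ^ Suc j \<noteq> 0" by simp
  have "qpoch q (1 / of_real q ^ Suc k) (Suc j) = (1 - 1 / r ^ Suc k) * X"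
    unfolding qpoch_Suc_shift X_def r_def using q_pos by simp
  moreover have "qpoch q (1 / of_real q ^ k) (Suc j) = X * (1 - r ^ j / r ^ k)"
    by (simp add: qpoch_Suc X_def r_def)
  moreover have "qpoch q (of_real q) (Suc j) = Y * (1 - r ^ Suc j)"
    by (simp add: qpoch_Suc Y_def r_def)
  moreover have "(1 - 1 / r ^ Suc k) * X / (Y * (1 - r ^ Suc j)) =
      X * (1 - r ^ j / r ^ k) / (Y * (1 - r ^ Suc j)) - X / Y / r ^ Suc k"
  proof -
    have "X / Y / r ^ Suc k = X * ((1 - r ^ Suc j) / r ^ Suc k) / (Y * (1 - r ^ Suc j))"
      using r1 by simp
    moreover have "(1 - r ^ j / r ^ k) - (1 - r ^ Suc j) / r ^ Suc k = 1 - 1 / r ^ Suc k"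
      using r by (simp add: field_simps)
    ultimately show ?thesis
      by (simp only: diff_divide_distrib[symmetric] right_diff_distrib[symmetric] mult.commute[of X])
         (simp only: left_diff_distrib[symmetric])
  qed
  ultimately show ?thesis by (simp only: qbeta_def X_def Y_def r_def)
qed

lemma sum_qbeta: "(\<Sum>j\<le>k. qbeta k j * z ^ j) = (\<Prod>i<k. 1 - z / of_real q ^ Suc i)"
proof (induction k)
  case (Suc k)
  let ?r = "complex_of_real q ^ Suc k"
  have "(\<Sum>j\<le>Suc k. qbeta (Suc k) j * z ^ j) = 1 + (\<Sum>j\<le>k. qbeta (Suc k) (Suc j) * z ^ Suc j)"
    by (simp only: sum.atMost_Suc_shift) simp
  also have "(\<Sum>j\<le>k. qbeta (Suc k) (Suc j) * z ^ Suc j) =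
      (\<Sum>j\<le>k. qbeta k (Suc j) * z ^ Suc j) - z / ?r * (\<Sum>j\<le>k. qbeta k j * z ^ j)"
    unfolding qbeta_Suc sum_distrib_left sum_subtractf[symmetric]
    by (intro sum.cong refl) (simp add: left_diff_distrib)
  also have "1 + ((\<Sum>j\<le>k. qbeta k (Suc j) * z ^ Suc j) - z / ?r * (\<Sum>j\<le>k. qbeta k j * z ^ j)) =
      (\<Sum>j\<le>Suc k. qbeta k j * z ^ j) - z / ?r * (\<Sum>j\<le>k. qbeta k j * z ^ j)"
    by (simp only: sum.atMost_Suc_shift) simp
  also have "(\<Sum>j\<le>Suc k. qbeta k j * z ^ j) = (\<Sum>j\<le>k. qbeta k j * z ^ j)"
    by (simp add: qbeta_eq_0)
  finally show ?case unfolding Suc by (simp add: algebra_simps)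
qed simp

text \<open>The \<open>k\<close>-th \<open>q\<close>-difference at \<open>a\<close> annihilates the powers of \<open>y\<close> below \<open>k\<close>.\<close>

lemma norm_q_difference_le:
  assumes f: "powser_majorised R f K" and a: "0 \<le> a" "a \<le> R" "0 < R"
  shows "norm (\<Sum>j\<le>k. qbeta k j * of_real q ^ j * f (of_real a * of_real q ^ j)) \<le> (a / R) ^ k * K"
proof -
  obtain c where c: "\<And>y. norm y \<le> R \<Longrightarrow> (\<lambda>n. c n * y ^ n) sums f y"
      "summable (\<lambda>n. norm (c n) * R ^ n)" "(\<Sum>n. norm (c n) * R ^ n) \<le> K"
    using f unfolding powser_majorised_def by blast
  \<comment> \<open>The q-difference sends y^n to a^n times the binomial sum at z = q^(n+1). Its
    factors are 1 - q^(n-i): the one with i = n vanishes if n < k, and all lie in [0, 1] if n >=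
    k.\<close>
  define B where "B = (\<lambda>n. \<Prod>i<k. 1 - complex_of_real q ^ Suc n / of_real q ^ Suc i)"
  have B0: "B n = 0" if "n < k" for n
    using that q_pos by (auto simp: B_def intro!: bexI[of _ n])
  have B1: "norm (B n) \<le> 1" if "k \<le> n" for n
  proof -
    have "norm (1 - complex_of_real q ^ Suc n / of_real q ^ Suc i) \<le> 1" if "i < k" for i
    proof -
      have "complex_of_real q ^ Suc n / of_real q ^ Suc i = of_real (q ^ (n - i))"
        using that \<open>k \<le> n\<close> q_pos by (simp add: power_diff)
      moreover have "0 \<le> q ^ (n - i)" "q ^ (n - i) \<le> 1"
        using q_pos q_less by (auto intro: power_le_one)
      moreover have "1 - complex_of_real (q ^ (n - i)) = of_real (1 - q ^ (n - i))" by simp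
      ultimately show ?thesis by (simp only: norm_of_real)
    qed
    then show ?thesis unfolding B_def prod_norm[symmetric]
      by (intro prod_le_1) auto
  qed
  have sums: "(\<lambda>n. \<Sum>j\<le>k. qbeta k j * of_real q ^ j * (c n * (of_real a * of_real q ^ j) ^ n)) sums
      (\<Sum>j\<le>k. qbeta k j * of_real q ^ j * f (of_real a * of_real q ^ j))"
  proof (intro sums_sum sums_mult c(1))
    fix j
    have "a * q ^ j \<le> a * 1" using a q_pos q_less by (intro mult_left_mono power_le_one) auto
    then show "norm (complex_of_real a * of_real q ^ j) \<le> R"
      using a q_pos by (simp add: norm_mult norm_power)
  qed
  have "(\<Sum>j\<le>k. qbeta k j * of_real q ^ j * (c n * (of_real a * of_real q ^ j) ^ n)) = c n * of_real a ^ n * B n" for n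
  proof -
    have "(\<Sum>j\<le>k. qbeta k j * of_real q ^ j * (c n * (of_real a * of_real q ^ j) ^ n)) =
        c n * of_real a ^ n * (\<Sum>j\<le>k. qbeta k j * (of_real q ^ Suc n) ^ j)"
      unfolding sum_distrib_left
      by (intro sum.cong refl) (simp add: power_mult_distrib mult_ac flip: power_mult)
    then show ?thesis by (simp only: sum_qbeta B_def)
  qed
  then have sums': "(\<lambda>n. c n * of_real a ^ n * B n) sums
      (\<Sum>j\<le>k. qbeta k j * of_real q ^ j * f (of_real a * of_real q ^ j))"
    using sums by simp
  have le: "norm (c n * of_real a ^ n * B n) \<le> (a / R) ^ k * (norm (c n) * R ^ n)" for n
  proof (cases "n < k")
    case True
    then show ?thesis using a by (simp add: B0)
  next
    case False
    have "norm (c n * of_real a ^ n * B n) \<le> norm (c n) * a ^ n * 1"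
      using B1[of n] False a unfolding norm_mult by (intro mult_mono) (auto simp: norm_power)
    also have "a ^ n = (a / R) ^ n * R ^ n" using a by (simp add: power_divide)
    also have "norm (c n) * ((a / R) ^ n * R ^ n) * 1 = (a / R) ^ n * (norm (c n) * R ^ n)" by simp
    also have "\<dots> \<le> (a / R) ^ k * (norm (c n) * R ^ n)"
      using False a by (intro mult_right_mono power_decreasing mult_nonneg_nonneg) auto
    finally show ?thesis .
  qed
  have "norm (\<Sum>n. c n * of_real a ^ n * B n) \<le> (\<Sum>n. (a / R) ^ k * (norm (c n) * R ^ n))"
    by (intro norm_suminf_le le summable_mult c(2))
  also have "\<dots> = (a / R) ^ k * (\<Sum>n. norm (c n) * R ^ n)"
    by (rule suminf_mult[OF c(2)])
  also have "\<dots> \<le> (a / R) ^ k * K" using a c(3) by (intro mult_left_mono) auto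
  finally show ?thesis using sums' by (simp add: sums_iff)
qed

section \<open>The terminating series as a q-difference of the weight\<close>

lemma P_nonzero_of_factors:
  assumes "\<And>i. z * of_real q ^ i \<noteq> 1"
  shows "P z \<noteq> 0"
proof -
  have "(\<lambda>n. norm (z * of_real q ^ n)) \<longlonglongrightarrow> 0"
    using tendsto_norm[OF qpow_tendsto_0[of z]] by simp
  then have "eventually (\<lambda>n. norm (z * of_real q ^ n) < 1) sequentially"
    by (rule order_tendstoD) simp
  then obtain n where "norm (z * of_real q ^ n) < 1"
    by (auto simp: eventually_sequentially)
  then show ?thesis
    using P_nonzero qpoch_nonzero[OF assms] by (subst P_split[of _ n]) simp
qed

text \<open>For real a, two lower parameters of the series are purely imaginary, so neither their
  q-shifted factorials nor \<open>H\<close> at a can vanish.\<close>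

lemma imaginary_neq_1: "\<i> * complex_of_real r * of_real q ^ i \<noteq> 1" "- \<i> * complex_of_real r * of_real q ^ i \<noteq> 1"
proof -
  have "Re (\<i> * complex_of_real r * of_real q ^ i) = 0" "Re (- \<i> * complex_of_real r * of_real q ^ i) = 0"
    by (simp_all flip: of_real_power)
  then show "\<i> * complex_of_real r * of_real q ^ i \<noteq> 1" "- \<i> * complex_of_real r * of_real q ^ i \<noteq> 1"
    by (metis one_complex.simps(1) zero_neq_one)+
qed

lemma H_nonzero: "H (of_real a) u \<noteq> 0"
  using P_nonzero_of_factors[OF imaginary_neq_1(1)[of "q * a * u"]]
    P_nonzero_of_factors[OF imaginary_neq_1(2)[of "q * a / u"]]
  by (simp add: H_def mult_ac)

lemma H_split:
  "H a u = qpoch q (\<i> * a * of_real q * of_real u) n * qpoch q (- \<i> * a * of_real q / of_real u) n * H (a * of_real q ^ n) u"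
proof -
  have "P (\<i> * of_real q * a * of_real u) = qpoch q (\<i> * a * of_real q * of_real u) n * P (\<i> * of_real q * (a * of_real q ^ n) * of_real u)"
    by (subst P_split[of _ n]) (simp add: mult_ac)
  moreover have "P (- \<i> * of_real q * a / of_real u) = qpoch q (- \<i> * a * of_real q / of_real u) n * P (- \<i> * of_real q * (a * of_real q ^ n) / of_real u)"
    by (subst P_split[of _ n]) (simp add: mult_ac)
  ultimately show ?thesis unfolding H_def by (simp add: mult_ac)
qed

text \<open>The factorials of the two t-dependent lower parameters are exactly what \<open>H\<close>
  loses when a becomes a q^j. Multiplication by \<open>H\<close> thus trades the denominator of the
  j-th term for a shift of the parameter.\<close>

lemma H_times_basic_hyp:
  fixes a :: real and b c d :: complex
  shows "H (of_real a) u * basic_hyp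
      [of_real q powi (- int k), of_real q * of_real a * b, of_real q * of_real a * c, of_real q * of_real a * d]
      [\<i> * of_real a * of_real q * of_real u, - \<i> * of_real a * of_real q / of_real u, of_real q * of_real a * b * c * d]
      q (of_real q) =
    (\<Sum>j\<le>k. qbeta k j * of_real q ^ j * (qpoch q (of_real q * of_real a * b) j * qpoch q (of_real q * of_real a * c) j
        * qpoch q (of_real q * of_real a * d) j / qpoch q (of_real q * of_real a * b * c * d) j
        * H (of_real a * of_real q ^ j) u))"
proof -
  define N where "N = (\<lambda>j. qpoch q (of_real q * of_real a * b) j * qpoch q (of_real q * of_real a * c) j
        * qpoch q (of_real q * of_real a * d) j / qpoch q (of_real q * of_real a * b * c * d) j)"
  define E where "E = (\<lambda>j. qpoch q (\<i> * of_real a * of_real q * of_real u) j * qpoch q (- \<i> * of_real a * of_real q / of_real u) j)"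
  have E0: "E j \<noteq> 0" for j
    using qpoch_nonzero[OF imaginary_neq_1(1)[of "a * q * u"], of j]
      qpoch_nonzero[OF imaginary_neq_1(2)[of "a * q / u"], of j]
    by (simp add: E_def mult_ac)
  have H: "H (of_real a) u = E j * H (of_real a * of_real q ^ j) u" for j
    unfolding E_def by (rule H_split)
  have powi: "complex_of_real q powi (- int k) = 1 / of_real q ^ k"
    by (simp add: power_int_minus inverse_eq_divide)
  \<comment> \<open>With four upper and three lower parameters the exponent 1 + s - r is 0, so the
    sign and power factor of the general series is 1.\<close>
  have "basic_hyp
      [of_real q powi (- int k), of_real q * of_real a * b, of_real q * of_real a * c, of_real q * of_real a * d]
      [\<i> * of_real a * of_real q * of_real u, - \<i> * of_real a * of_real q / of_real u, of_real q * of_real a * b * c * d]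
      q (of_real q) = (\<Sum>j. qbeta k j * of_real q ^ j * (N j / E j))"
    unfolding basic_hyp_def qpochs_def powi qbeta_def N_def E_def
    by (intro suminf_cong) (simp add: mult_ac)
  also have "\<dots> = (\<Sum>j\<le>k. qbeta k j * of_real q ^ j * (N j / E j))"
    by (intro suminf_finite) (auto simp: qbeta_eq_0)
  finally have "H (of_real a) u * basic_hyp
      [of_real q powi (- int k), of_real q * of_real a * b, of_real q * of_real a * c, of_real q * of_real a * d]
      [\<i> * of_real a * of_real q * of_real u, - \<i> * of_real a * of_real q / of_real u, of_real q * of_real a * b * c * d]
      q (of_real q) = (\<Sum>j\<le>k. H (of_real a) u * (qbeta k j * of_real q ^ j * (N j / E j)))"
    by (simp only: sum_distrib_left)
  also have "\<dots> = (\<Sum>j\<le>k. qbeta k j * of_real q ^ j * (N j * H (of_real a * of_real q ^ j) u))"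
  proof (intro sum.cong refl)
    fix j
    show "H (of_real a) u * (qbeta k j * of_real q ^ j * (N j / E j)) =
        qbeta k j * of_real q ^ j * (N j * H (of_real a * of_real q ^ j) u)"
      using E0[of j] by (subst H[of j]) simp
  qed
  finally show ?thesis unfolding N_def .
qed


subsection \<open>The expansion and its termwise integration\<close>

lemma obtain_radius:
  fixes ws :: "complex list" and x :: real
  assumes "\<And>w. w \<in> set ws \<Longrightarrow> norm (of_real q * of_real x * w) < 1"
  obtains R where "x < R" "\<And>w. w \<in> set ws \<Longrightarrow> norm (of_real q * of_real R * w) < 1"
proof -
  have "\<forall>w\<in>set ws. eventually (\<lambda>R. norm (of_real q * of_real R * w) < 1) (at_right x)"
  proof
    fix w assume w: "w \<in> set ws"
    have "((\<lambda>R. norm (of_real q * of_real R * w)) \<longlongrightarrow> norm (of_real q * of_real x * w)) (at_right x)"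
      by (intro tendsto_intros)
    then show "eventually (\<lambda>R. norm (of_real q * of_real R * w) < 1) (at_right x)"
      using assms[OF w] by (rule order_tendstoD(2))
  qed
  then have "eventually (\<lambda>R. \<forall>w\<in>set ws. norm (of_real q * of_real R * w) < 1) (at_right x)"
    by (intro eventually_ball_finite) auto
  then have "eventually (\<lambda>R. x < R \<and> (\<forall>w\<in>set ws. norm (of_real q * of_real R * w) < 1)) (at_right x)"
    using eventually_at_right_less[of x] by (simp add: eventually_conj_iff)
  then obtain R where "x < R" "\<forall>w\<in>set ws. norm (of_real q * of_real R * w) < 1"
    using eventually_happens' trivial_limit_at_right_real by blast
  then show ?thesis using that by blast
qed

text \<open>Since q^(\<alpha> + k) tends to 0, both shifted products tend to 1 and the ratio
  converges. The coefficients of the outer series therefore grow no faster than (x/a)^k.\<close>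

lemma qpoch_real_ratio_bounded:
  fixes y :: complex
  shows "\<exists>C. \<forall>k. norm (qpoch_real q y (\<alpha> + real k) / qpoch_real q (of_real q) (\<alpha> + real k)) \<le> C"
proof -
  have "(\<lambda>k. q powr (\<alpha> + real k)) = (\<lambda>k. q powr \<alpha> * q ^ k)"
    using q_pos by (simp add: powr_add powr_realpow)
  then have "(\<lambda>k. q powr (\<alpha> + real k)) \<longlonglongrightarrow> 0"
    using tendsto_mult_right_zero[OF q_tendsto_0] by simp
  then have 0: "(\<lambda>k. complex_of_real (q powr (\<alpha> + real k))) \<longlonglongrightarrow> 0"
    using tendsto_of_real by fastforce
  have Pq: "P (of_real q) \<noteq> 0"
    using q_pos q_less by (intro P_nonzero) simp
  have "(\<lambda>k. P (z * complex_of_real (q powr (\<alpha> + real k)))) \<longlonglongrightarrow> P (z * 0)" for z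
    by (intro tendsto_P tendsto_mult tendsto_const 0)
  then have 1: "(\<lambda>k. P (z * complex_of_real (q powr (\<alpha> + real k)))) \<longlonglongrightarrow> 1" for z by simp
  have "(\<lambda>k. qpoch_real q y (\<alpha> + real k) / qpoch_real q (of_real q) (\<alpha> + real k)) \<longlonglongrightarrow>
      (P y / 1) / (P (of_real q) / 1)"
    unfolding qpoch_real_def using Pq by (intro tendsto_intros 1) auto
  then have "Bseq (\<lambda>k. qpoch_real q y (\<alpha> + real k) / qpoch_real q (of_real q) (\<alpha> + real k))"
    by (rule convergent_imp_Bseq[OF convergentI])
  then show ?thesis unfolding Bseq_def by blast
qed

lemma P_divide_split:
  assumes "norm (w * of_real q ^ j) < 1"
  shows "P w / P (w * of_real q ^ j) = qpoch q w j"
  using P_split[of w j] P_nonzero[OF assms] by (simp add: field_simps)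

text \<open>The sum is a constant times the k-th q-difference of y -> \<open>H y u * g y\<close>.
  Only \<open>H\<close> depends on u, and its majorant is \<open>HA R u\<close>, so a single
  \<open>K\<close> serves all u and k.\<close>

lemma expansion_bound:
  fixes a x R :: real and b c d :: complex
  assumes a: "0 < a" "a < R"
    and conv: "norm (of_real q * of_real R * b) < 1" "norm (of_real q * of_real R * c) < 1"
      "norm (of_real q * of_real R * d) < 1" 
    and abcd: "norm (of_real q * of_real a * b * c * d) < 1"
  shows "\<exists>K. \<forall>u>0. \<forall>k. norm (\<Sum>j\<le>k. qbeta k j * of_real q ^ j * (qpoch q (of_real q * of_real a * b) j
        * qpoch q (of_real q * of_real a * c) j * qpoch q (of_real q * of_real a * d) j
        / qpoch q (of_real q * of_real a * b * c * d) j * H (of_real a * of_real q ^ j) u))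
      \<le> (a / R) ^ k * (K * HA R u)"
proof -
  have R: "R \<ge> 0" "R > 0" using a by simp_all
  let ?q = "complex_of_real q" and ?a = "complex_of_real a"
  define g where "g = (\<lambda>y. P (?q * b * c * d * y) * ((1 / P (?q * b * y)) * ((1 / P (?q * c * y)) * (1 / P (?q * d * y)))))"
  have inv: "\<exists>K. powser_majorised R (\<lambda>y. 1 / P (?q * w * y)) K" if "norm (?q * of_real R * w) < 1" for w
    using that R q_pos by (intro powser_majorised_inverse_P) (auto simp: norm_mult mult_ac)
  obtain Kb Kc Kd where K: "powser_majorised R (\<lambda>y. 1 / P (?q * b * y)) Kb"
     "powser_majorised R (\<lambda>y. 1 / P (?q * c * y)) Kc" "powser_majorised R (\<lambda>y. 1 / P (?q * d * y)) Kd"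
    using inv[OF conv(1)] inv[OF conv(2)] inv[OF conv(3)] by blast
  define K where "K = A (norm (?q * b * c * d) * R) * (Kb * (Kc * Kd))"
  have g: "powser_majorised R g K"
    unfolding g_def K_def by (intro powser_majorised_mult K R powser_majorised_P order_refl)
  have Hm: "powser_majorised R (\<lambda>y. H y u) (HA R u)" if "u > 0" for u
  proof -
    have "powser_majorised R (\<lambda>y. P (\<i> * ?q * of_real u * y) * P (- \<i> * ?q / of_real u * y)) (A (q * u * R) * A (q / u * R))"
      using that q_pos by (intro powser_majorised_mult powser_majorised_P R) (auto simp: norm_mult norm_divide)
    then show ?thesis by (simp add: H_def HA_def mult_ac)
  qed
  \<comment> \<open>Normalised by \<open>\<kappa> * g a = 1\<close>, the value of the coefficient at
    j = 0.\<close>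
  define \<kappa> where "\<kappa> = P (?q * ?a * b) * P (?q * ?a * c) * P (?q * ?a * d) / P (?q * ?a * b * c * d)"
  have lt: "norm (?q * ?a * w * ?q ^ j) < 1" if "norm (?q * of_real R * w) < 1" for w j
  proof -
    have "norm (?q * ?a * w * ?q ^ j) = q * a * norm w * q ^ j"
      using a q_pos by (simp add: norm_mult norm_power)
    also have "\<dots> \<le> q * R * norm w * 1"
      using a q_pos q_less by (intro mult_mono mult_nonneg_nonneg power_le_one) auto
    also have "\<dots> = norm (?q * of_real R * w)"
      using R q_pos by (simp add: norm_mult)
    finally show ?thesis using that by simp
  qed
  have lt': "norm (?q * ?a * b * c * d * ?q ^ j) < 1" for j
    by (rule norm_mult_q_power_less_1[OF abcd])
  have coeff: "qpoch q (?q * ?a * b) j * qpoch q (?q * ?a * c) j * qpoch q (?q * ?a * d) j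
        / qpoch q (?q * ?a * b * c * d) j = \<kappa> * g (?a * ?q ^ j)" for j
  proof -
    have "\<kappa> * g (?a * ?q ^ j) = (P (?q * ?a * b) / P (?q * ?a * b * ?q ^ j)) * (P (?q * ?a * c) / P (?q * ?a * c * ?q ^ j))
       * (P (?q * ?a * d) / P (?q * ?a * d * ?q ^ j)) / (P (?q * ?a * b * c * d) / P (?q * ?a * b * c * d * ?q ^ j))"
      by (simp add: \<kappa>_def g_def mult_ac)
    then show ?thesis by (simp only: P_divide_split[OF lt[OF conv(1)]] P_divide_split[OF lt[OF conv(2)]]
        P_divide_split[OF lt[OF conv(3)]] P_divide_split[OF lt'])
  qed
  have "norm (\<Sum>j\<le>k. qbeta k j * ?q ^ j * (qpoch q (?q * ?a * b) j
        * qpoch q (?q * ?a * c) j * qpoch q (?q * ?a * d) j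
        / qpoch q (?q * ?a * b * c * d) j * H (?a * ?q ^ j) u)) \<le> (a / R) ^ k * (norm \<kappa> * K * HA R u)"
    if u: "u > 0" for u k
  proof -
    have "norm (\<Sum>j\<le>k. qbeta k j * ?q ^ j * (H (?a * ?q ^ j) u * g (?a * ?q ^ j))) \<le> (a / R) ^ k * (HA R u * K)"
      using a by (intro norm_q_difference_le powser_majorised_mult Hm g u) auto
    then have "norm \<kappa> * norm (\<Sum>j\<le>k. qbeta k j * ?q ^ j * (H (?a * ?q ^ j) u * g (?a * ?q ^ j)))
        \<le> norm \<kappa> * ((a / R) ^ k * (HA R u * K))"
      by (intro mult_left_mono) auto
    moreover have "(\<Sum>j\<le>k. qbeta k j * ?q ^ j * (\<kappa> * g (?a * ?q ^ j) * H (?a * ?q ^ j) u)) =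
        \<kappa> * (\<Sum>j\<le>k. qbeta k j * ?q ^ j * (H (?a * ?q ^ j) u * g (?a * ?q ^ j)))"
      by (simp add: sum_distrib_left mult_ac)
    ultimately show ?thesis unfolding coeff by (simp add: norm_mult mult_ac)
  qed
  then show ?thesis by blast
qed

text \<open>By \<open>I_iterate\<close> the coefficient of the j-th summand turns the integral at a
  q^j into the one at a. What remains is the binomial sum at z = q, whose factor i = 0 is 1 - q/q,
  so only the empty product k = 0 survives.\<close>

lemma integral_term:
  fixes a :: real and b c d :: complex
  assumes abcd: "norm (of_real q * of_real a * b * c * d) < 1"
  shows "has_bochner_integral lborel (\<lambda>t. \<Sum>j\<le>k. qbeta k j * of_real q ^ j * (qpoch q (of_real q * of_real a * b) j
        * qpoch q (of_real q * of_real a * c) j * qpoch q (of_real q * of_real a * d) j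
        / qpoch q (of_real q * of_real a * b * c * d) j * W (of_real a * of_real q ^ j) b c d (exp t)))
      (if k = 0 then I (of_real a) b c d else 0)"
proof -
  let ?q = "complex_of_real q" and ?a = "complex_of_real a"
  have lt': "norm (?q * ?a * b * c * d * ?q ^ j) < 1" for j
    by (rule norm_mult_q_power_less_1[OF abcd])
  have nz: "qpoch q (?q * ?a * b * c * d) j \<noteq> 0" for j
  proof (rule qpoch_nonzero)
    show "?q * ?a * b * c * d * ?q ^ i \<noteq> 1" for i using lt'[of i] by (metis less_irrefl norm_one)
  qed
  have "integrable lborel (\<lambda>t. W (?a * ?q ^ j) b c d (exp t))" for j
    using lt'[of j] by (intro integrable_W) (simp add: mult_ac)
  then have W: "has_bochner_integral lborel (\<lambda>t. W (?a * ?q ^ j) b c d (exp t)) (I (?a * ?q ^ j) b c d)" for j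
    unfolding I_def by (rule has_bochner_integral_integrable)
  have eq: "qpoch q (?q * ?a * b) j * qpoch q (?q * ?a * c) j * qpoch q (?q * ?a * d) j
        / qpoch q (?q * ?a * b * c * d) j * I (?a * ?q ^ j) b c d = I ?a b c d" for j
    using I_iterate[OF abcd, of j] nz[of j] by (simp add: field_simps)
  have "has_bochner_integral lborel (\<lambda>t. \<Sum>j\<le>k. qbeta k j * ?q ^ j * (qpoch q (?q * ?a * b) j
        * qpoch q (?q * ?a * c) j * qpoch q (?q * ?a * d) j
        / qpoch q (?q * ?a * b * c * d) j * W (?a * ?q ^ j) b c d (exp t)))
      (\<Sum>j\<le>k. qbeta k j * ?q ^ j * (qpoch q (?q * ?a * b) j
        * qpoch q (?q * ?a * c) j * qpoch q (?q * ?a * d) j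
        / qpoch q (?q * ?a * b * c * d) j * I (?a * ?q ^ j) b c d))"
    by (intro has_bochner_integral_sum has_bochner_integral_mult_right W)
  also have "(\<Sum>j\<le>k. qbeta k j * ?q ^ j * (qpoch q (?q * ?a * b) j
        * qpoch q (?q * ?a * c) j * qpoch q (?q * ?a * d) j
        / qpoch q (?q * ?a * b * c * d) j * I (?a * ?q ^ j) b c d)) = (\<Sum>j\<le>k. qbeta k j * ?q ^ j) * I ?a b c d"
    unfolding eq by (simp only: sum_distrib_right)
  also have "(\<Sum>j\<le>k. qbeta k j * ?q ^ j) = (if k = 0 then 1 else 0)"
    unfolding sum_qbeta using q_pos by (auto intro!: bexI[of _ 0])
  finally show ?thesis by (simp split: if_splits)
qed

text \<open>Coefficient growth (x/a)^k and difference decay (a/R)^k combine to (x/R)^k, times a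
  majorant integrable in t. Sum and integral may then be interchanged, and only the term k = 0
  contributes.\<close>

lemma fractional_askey_integral:
  fixes \<alpha> a x :: real and b c d :: complex and S :: "real \<Rightarrow> nat \<Rightarrow> complex"
  defines "S \<equiv> (\<lambda>u k.
      of_real (x powr (\<alpha> + real k)) * qpoch_real q (of_real (a / x)) (\<alpha> + real k)
        / (of_real a ^ k * qpoch_real q (of_real q) (\<alpha> + real k))
        * basic_hyp
            [of_real q powi (- int k), of_real q * of_real a * b, of_real q * of_real a * c,
             of_real q * of_real a * d]
            [\<i> * of_real a * of_real q * of_real u,
             - \<i> * of_real a * of_real q / of_real u,
             of_real q * of_real a * b * c * d]
            q (of_real q))"
  assumes ax: "0 < a" "a < x"
    and abcd: "norm (of_real q * of_real a * b * c * d) < 1"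
    and conv: "norm (of_real q * of_real x * b) < 1" "norm (of_real q * of_real x * c) < 1"
      "norm (of_real q * of_real x * d) < 1" "norm (of_real q * of_real x * (b * c * d)) < 1"
  shows "u > 0 \<Longrightarrow> summable (S u)"
    and "has_bochner_integral lborel (\<lambda>t. W (of_real a) b c d (exp t) * (\<Sum>k. S (exp t) k))
      (of_real (x powr \<alpha>) * qpoch_real q (of_real (a / x)) \<alpha> / qpoch_real q (of_real q) \<alpha> * I (of_real a) b c d)"
proof -
  let ?q = "complex_of_real q" and ?a = "complex_of_real a"
  obtain R where R: "x < R" and convR: "\<And>w. w \<in> set [b, c, d, b * c * d] \<Longrightarrow> norm (?q * of_real R * w) < 1"
    using obtain_radius[of "[b, c, d, b * c * d]" x] conv by auto
  define \<Phi> where "\<Phi> = (\<lambda>k u. \<Sum>j\<le>k. qbeta k j * ?q ^ j * (qpoch q (?q * ?a * b) j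
        * qpoch q (?q * ?a * c) j * qpoch q (?q * ?a * d) j
        / qpoch q (?q * ?a * b * c * d) j * H (?a * ?q ^ j) u))"
  obtain K where K: "\<And>u k. u > 0 \<Longrightarrow> norm (\<Phi> k u) \<le> (a / R) ^ k * (K * HA R u)"
    unfolding \<Phi>_def using expansion_bound[of a R b c d] ax R abcd convR by auto
  define s where "s = (\<lambda>k. of_real (x powr (\<alpha> + real k)) * qpoch_real q (of_real (a / x)) (\<alpha> + real k)
        / (?a ^ k * qpoch_real q ?q (\<alpha> + real k)))"
  obtain C where C: "\<And>k. norm (qpoch_real q (of_real (a / x)) (\<alpha> + real k) / qpoch_real q ?q (\<alpha> + real k)) \<le> C"
    using qpoch_real_ratio_bounded by blast
  have C0: "C \<ge> 0" using order_trans[OF norm_ge_zero C[of 0]] .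
  have s: "norm (s k) \<le> x powr \<alpha> * C * (x / a) ^ k" for k
  proof -
    have "norm (s k) = x powr (\<alpha> + real k) / a ^ k * norm (qpoch_real q (of_real (a / x)) (\<alpha> + real k) / qpoch_real q ?q (\<alpha> + real k))"
      using ax by (simp add: s_def norm_mult norm_divide norm_power)
    also have "x powr (\<alpha> + real k) / a ^ k = x powr \<alpha> * (x / a) ^ k"
      using ax by (simp add: powr_add powr_realpow power_divide)
    also have "x powr \<alpha> * (x / a) ^ k * norm (qpoch_real q (of_real (a / x)) (\<alpha> + real k) / qpoch_real q ?q (\<alpha> + real k))
        \<le> x powr \<alpha> * (x / a) ^ k * C"
      using C ax by (intro mult_left_mono) auto
    finally show ?thesis by (simp add: mult_ac)
  qed
  have S: "H ?a u * S u k = s k * \<Phi> k u" for u k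
    unfolding S_def s_def \<Phi>_def H_times_basic_hyp[symmetric] by (simp only: mult_ac)
  define B where "B = (\<lambda>u. x powr \<alpha> * C * (K * HA R u))"
  have bound: "norm (s k * \<Phi> k u) \<le> (x / R) ^ k * B u" if "u > 0" for u k
  proof -
    have "norm (s k * \<Phi> k u) \<le> (x powr \<alpha> * C * (x / a) ^ k) * ((a / R) ^ k * (K * HA R u))"
      unfolding norm_mult using s K[OF that] C0 ax by (intro mult_mono) auto
    also have "\<dots> = (x / R) ^ k * B u"
      using ax by (simp add: B_def power_divide)
    finally show ?thesis .
  qed
  have geom: "summable (\<lambda>k. (x / R) ^ k)"
    using ax R by (intro summable_geometric) simp
  have sum_s\<Phi>: "summable (\<lambda>k. norm (s k * \<Phi> k u))" if "u > 0" for u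
    using bound[OF that] by (intro summable_comparison_test'[OF summable_mult2[OF geom], of 0]) auto
  \<comment> \<open>All estimates concern \<open>H\<close> times the series; as \<open>H\<close>
    does not vanish at real a, convergence passes back to the series itself.\<close>
  have S_eq: "S u = (\<lambda>k. 1 / H ?a u * (s k * \<Phi> k u))" for u
    using H_nonzero[of a u] by (auto simp: fun_eq_iff S[symmetric])
  show summable_S: "summable (S u)" if "u > 0" for u
    unfolding S_eq by (intro summable_mult summable_norm_cancel[OF sum_s\<Phi>] that)
  define V where "V = (\<lambda>u. H b u * H c u * H d u / of_real (D u))"
  define F where "F = (\<lambda>k t. V (exp t) * (s k * \<Phi> k (exp t)))"
  have F_eq: "F k t = s k * (\<Sum>j\<le>k. qbeta k j * ?q ^ j * (qpoch q (?q * ?a * b) j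
        * qpoch q (?q * ?a * c) j * qpoch q (?q * ?a * d) j
        / qpoch q (?q * ?a * b * c * d) j * W (?a * ?q ^ j) b c d (exp t)))" for k t
    unfolding F_def \<Phi>_def V_def W_def by (simp add: sum_distrib_left mult_ac)
  have hbi: "has_bochner_integral lborel (F k) (s k * (if k = 0 then I ?a b c d else 0))" for k
    unfolding F_eq[abs_def] by (intro has_bochner_integral_mult_right integral_term abcd)
  have int: "integrable lborel (F k)" for k using hbi by (rule integrable.intros)
  have R0: "R > 0" using ax R by simp
  define B' where "B' = (\<lambda>t. x powr \<alpha> * C * K * M R (norm b) (norm c) (norm d) (exp t))"
  have "q * R * norm b * norm c * norm d < 1"
    using convR[of "b * c * d"] R0 q_pos by (simp add: norm_mult mult.assoc)
  then have intB': "integrable lborel B'"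
    unfolding B'_def using R0 by (intro integrable_mult_right integrable_M) auto
  have V: "norm (V u) * HA R u \<le> M R (norm b) (norm c) (norm d) u" if "u > 0" for u
  proof -
    have "norm (V u) * HA R u = HA R u * norm (H b u) * norm (H c u) * norm (H d u) / D u"
      using D_pos[OF that] by (simp add: V_def norm_mult norm_divide)
    also have "\<dots> \<le> HA R u * HA (norm b) u * HA (norm c) u * HA (norm d) u / D u"
      using that R0 by (intro divide_right_mono mult_mono norm_H_le order_refl mult_nonneg_nonneg HA_nonneg
          norm_ge_zero less_imp_le[OF D_pos]) auto
    finally show ?thesis by (simp add: M_def)
  qed
  \<comment> \<open>\<open>K\<close> came from a bare existence statement; its sign is recovered
    from the bound at k = 0, u = 1.\<close>
  have K0: "K \<ge> 0"
  proof -
    have "0 \<le> norm (\<Phi> 0 1)" by simp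
    also have "\<dots> \<le> K * HA R 1" using K[of 1 0] by simp
    finally show ?thesis using HA_pos[of 1 R] R0 by (simp add: zero_le_mult_iff)
  qed
  have normF: "norm (F k t) \<le> (x / R) ^ k * B' t" for k t
  proof -
    have "norm (F k t) \<le> norm (V (exp t)) * ((x / R) ^ k * B (exp t))"
      unfolding F_def norm_mult[of "V _"] by (intro mult_left_mono bound) auto
    also have "\<dots> = (x / R) ^ k * (x powr \<alpha> * C * K) * (norm (V (exp t)) * HA R (exp t))"
      by (simp add: B_def mult_ac)
    also have "\<dots> \<le> (x / R) ^ k * (x powr \<alpha> * C * K) * M R (norm b) (norm c) (norm d) (exp t)"
      using ax R0 C0 K0 by (intro mult_left_mono V mult_nonneg_nonneg) auto
    finally show ?thesis by (simp add: B'_def mult_ac)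
  qed
  have sumF: "AE t in lborel. summable (\<lambda>k. norm (F k t))"
    using normF by (intro AE_I2 summable_comparison_test'[OF summable_mult2[OF geom], of 0]) auto
  have "(LINT t|lborel. norm (F k t)) \<le> (x / R) ^ k * (LINT t|lborel. B' t)" for k
  proof -
    have "(LINT t|lborel. norm (F k t)) \<le> (LINT t|lborel. (x / R) ^ k * B' t)"
      using int intB' normF by (intro integral_mono) auto
    then show ?thesis by simp
  qed
  then have sumI: "summable (\<lambda>k. LINT t|lborel. norm (F k t))"
    by (intro summable_comparison_test'[OF summable_mult2[OF geom], of 0]) auto
  have "has_bochner_integral lborel (\<lambda>t. \<Sum>k. F k t) (\<Sum>k. LINT t|lborel. F k t)"
    using integrable_suminf[OF int sumF sumI] integral_suminf[OF int sumF sumI]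
    by (simp add: has_bochner_integral_iff)
  also have "(\<Sum>k. LINT t|lborel. F k t) = (\<Sum>k\<in>{0}. s k * (if k = 0 then I ?a b c d else 0))"
    unfolding has_bochner_integral_integral_eq[OF hbi] by (intro suminf_finite) auto
  also have "\<dots> = of_real (x powr \<alpha>) * qpoch_real q (of_real (a / x)) \<alpha> / qpoch_real q ?q \<alpha> * I ?a b c d"
    by (simp add: s_def)
  also have "(\<lambda>t. \<Sum>k. F k t) = (\<lambda>t. W ?a b c d (exp t) * (\<Sum>k. S (exp t) k))"
  proof
    fix t
    have "W ?a b c d (exp t) * (\<Sum>k. S (exp t) k) = (\<Sum>k. W ?a b c d (exp t) * S (exp t) k)"
      by (intro suminf_mult[symmetric] summable_S) simp
    moreover have "W ?a b c d (exp t) * S (exp t) k = F k t" for k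
      unfolding F_def S[symmetric] by (simp add: W_def V_def)
    ultimately show "(\<Sum>k. F k t) = W ?a b c d (exp t) * (\<Sum>k. S (exp t) k)" by simp
  qed
  finally show "has_bochner_integral lborel (\<lambda>t. W ?a b c d (exp t) * (\<Sum>k. S (exp t) k))
      (of_real (x powr \<alpha>) * qpoch_real q (of_real (a / x)) \<alpha> / qpoch_real q ?q \<alpha> * I ?a b c d)" .
qed

end

text \<open>Summability is asserted separately because an infinite sum has some default value even
  when it diverges; \<open>has_bochner_integral\<close> states integrability together with the
  value.\<close>

theorem theorem12:
  fixes q \<alpha> a x :: real and b c d :: complex
    and S :: "real \<Rightarrow> nat \<Rightarrow> complex"
  defines "S \<equiv> (\<lambda>t k.
      of_real (x powr (\<alpha> + real k)) * qpoch_real q (of_real (a / x)) (\<alpha> + real k)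
        / (of_real a ^ k * qpoch_real q (of_real q) (\<alpha> + real k))
        * basic_hyp
            [of_real q powi (- int k), of_real q * of_real a * b, of_real q * of_real a * c,
             of_real q * of_real a * d]
            [\<i> * of_real a * of_real q * of_real (exp t),
             - \<i> * of_real a * of_real q * of_real (exp (- t)),
             of_real q * of_real a * b * c * d]
            q (of_real q))"
  assumes q: "0 < q" "q < 1"
    and \<alpha>: "0 < \<alpha>"
    and ax: "0 < a" "a < x" "x < 1"
    and qabcd: "norm (of_real q * of_real a * b * c * d) < 1"
    and series_conv: "norm (of_real q * of_real x * b) < 1" "norm (of_real q * of_real x * c) < 1"
      "norm (of_real q * of_real x * d) < 1"
    and integral_conv: "norm (of_real q * of_real x * b * c * d) < 1"
  shows "(\<forall>t. summable (S t)) \<and>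
    has_bochner_integral lborel
      (\<lambda>t. h_funs q (\<i> * of_real (sinh t))
              [of_real q * of_real a, of_real q * b, of_real q * c, of_real q * d]
            / h_fun q (of_real (cosh (2 * t))) (- of_real q)
            * (\<Sum>k. S t k))
      (qpochs_inf q
          [of_real q, of_real q * of_real a * b, of_real q * of_real a * c, of_real q * of_real a * d,
           of_real q * b * c, of_real q * b * d, of_real q * c * d]
        / qpoch_inf q (of_real q * of_real a * b * c * d)
        * (of_real (x powr \<alpha>) * qpoch_real q (of_real (a / x)) \<alpha> / qpoch_real q (of_real q) \<alpha>)
        * of_real (ln (1 / q)))"
proof -
  interpret nome q using q by unfold_locales
  have exp_minus': "complex_of_real (exp (- t)) = 1 / of_real (exp t)" for t
    by (simp add: exp_minus inverse_eq_divide)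
  have S_exp: "S t = (\<lambda>k.
      of_real (x powr (\<alpha> + real k)) * qpoch_real q (of_real (a / x)) (\<alpha> + real k)
        / (of_real a ^ k * qpoch_real q (of_real q) (\<alpha> + real k))
        * basic_hyp
            [of_real q powi (- int k), of_real q * of_real a * b, of_real q * of_real a * c,
             of_real q * of_real a * d]
            [\<i> * of_real a * of_real q * of_real (exp t),
             - \<i> * of_real a * of_real q / of_real (exp t),
             of_real q * of_real a * b * c * d]
            q (of_real q))" for t
    unfolding S_def exp_minus' by (simp only: times_divide_eq_right mult_1_right)
  have conv: "norm (of_real q * of_real x * (b * c * d)) < 1"
    using integral_conv by (simp only: mult.assoc)
  have H: "h_fun q (\<i> * of_real (sinh t)) (of_real q * p) = H p (exp t)" for p t
    unfolding h_fun_i_sinh[OF q] exp_minus' by (simp add: qpochs_inf_def H_def mult.assoc)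
  have D: "h_fun q (of_real (cosh (2 * t))) (- of_real q) = of_real (D (exp t))" for t
    unfolding h_fun_cosh[OF q] of_real_D[OF exp_gt_zero]
    by (simp add: qpochs_inf_def exp_double[symmetric] exp_minus inverse_eq_divide exp_of_nat_mult)
  have W: "h_funs q (\<i> * of_real (sinh t)) [of_real q * of_real a, of_real q * b, of_real q * c, of_real q * d]
      / h_fun q (of_real (cosh (2 * t))) (- of_real q) = W (of_real a) b c d (exp t)" for t
    unfolding D by (simp add: h_funs_def H W_def mult.assoc)
  have P: "P (of_real q * of_real a * b * c * d) \<noteq> 0"
    by (rule P_nonzero[OF qabcd])
  have I: "I (of_real a) b c d = qpochs_inf q
          [of_real q, of_real q * of_real a * b, of_real q * of_real a * c, of_real q * of_real a * d,
           of_real q * b * c, of_real q * b * d, of_real q * c * d]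
        / qpoch_inf q (of_real q * of_real a * b * c * d) * of_real (ln (1 / q))"
    using askey_integral[OF qabcd] P by (simp add: qpochs_inf_def L_def eq_divide_eq mult_ac)
  note main = fractional_askey_integral[OF ax(1,2) qabcd series_conv conv]
  have "summable (S t)" for t
    unfolding S_exp by (rule main(1)) simp
  moreover have "has_bochner_integral lborel (\<lambda>t. W (of_real a) b c d (exp t) * (\<Sum>k. S t k))
      (of_real (x powr \<alpha>) * qpoch_real q (of_real (a / x)) \<alpha> / qpoch_real q (of_real q) \<alpha> * I (of_real a) b c d)"
    unfolding S_exp by (rule main(2))
  ultimately show ?thesis
    unfolding W I by (simp add: mult_ac)
qed

end
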